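(* There exist universal constants $c,c'>0$ such that the following holds. Let $n,d$ be integers with $d<n/2$. There exists a polynomial $f\colon\mathbb{F}_2^n\to\mathbb{F}_2$ of degree $d$ such that for every affine subspace $u_0+U\subseteq\mathbb{F}_2^n$ of dimension $k\ge c\,d\cdot n^{1/(d-1)}$, it holds that $\mathrm{bias}(f|_{u_0+U})\le 2^{-c'k/d}$.
   Context: For a function $g$ on a finite set $S$ with values in $\mathbb{F}_2$, $\mathrm{bias}(g)=\big|\mathbb{E}_{x\sim S}[(-1)^{g(x)}]\big|$ with $x$ uniform in $S$; $f|_{u_0+U}$ denotes the restriction of $f$ to $u_0+U$. *)

theory Defs
  imports Complex_Main "HOL-Library.Z2" "Jordan_Normal_Form.VS_Connect"
begin

text \<open>
  The vector space of dimension \<open>n\<close> over the two-element field \<^typ>\<open>bit\<close>, with carrier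
  \<open>carrier_vec n\<close>. Coordinates are numbered from 0.
\<close>

abbreviation F2_space :: "nat \<Rightarrow> (bit, bit vec) module" where
  "F2_space n \<equiv> module_vec TYPE(bit) n"

definition F2_subspace :: "nat \<Rightarrow> bit vec set \<Rightarrow> bool" where
  "F2_subspace n U \<longleftrightarrow> VectorSpace.subspace class_ring U (F2_space n)"

definition F2_dim :: "nat \<Rightarrow> bit vec set \<Rightarrow> nat" where
  "F2_dim n U = vectorspace.dim class_ring (F2_space n\<lparr>carrier := U\<rparr>)"

text \<open>
  As usual over the two-element field, where \<open>x ^ 2 = x\<close>, polynomials are taken in reduced
  (multilinear) form: each monomial is a product of distinct variables, so a polynomial in \<open>n\<close>
  variables is a family of coefficients \<open>a S\<close> indexed by the subsets \<open>S\<close> of \<open>{..<n}\<close>. Values of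
  \<open>a\<close> at other sets are ignored. Every function on the space has exactly one such representation,
  and its degree is the size of the largest monomial that occurs (0 for the zero polynomial).
\<close>

definition F2_poly_eval :: "nat \<Rightarrow> (nat set \<Rightarrow> bit) \<Rightarrow> bit vec \<Rightarrow> bit" where
  "F2_poly_eval n a x = (\<Sum>S\<in>Pow {..<n}. a S * (\<Prod>i\<in>S. x $ i))"

definition F2_poly_degree :: "nat \<Rightarrow> (nat set \<Rightarrow> bit) \<Rightarrow> nat" where
  "F2_poly_degree n a = Max (insert 0 (card ` {S \<in> Pow {..<n}. a S \<noteq> 0}))"

text \<open>The sign \<open>(-1) ^ b\<close> of an element \<open>b\<close> of the two-element field.\<close>

definition bit_sign :: "bit \<Rightarrow> real" where
  "bit_sign b = (if b = 0 then 1 else - 1)"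

text \<open>Meant for finite nonempty \<open>S\<close>; the expectation is the average over \<open>S\<close>.\<close>

definition bias :: "'a set \<Rightarrow> ('a \<Rightarrow> bit) \<Rightarrow> real" where
  "bias S g = \<bar>(\<Sum>x\<in>S. bit_sign (g x)) / real (card S)\<bar>"

definition affine_translate :: "bit vec \<Rightarrow> bit vec set \<Rightarrow> bit vec set" where
  "affine_translate u\<^sub>0 U = (\<lambda>u. u\<^sub>0 + u) ` U"

end

theory Submission
  imports Defs "HOL-Library.FuncSet"
begin

text \<open>
  Take a uniformly random polynomial \<open>f\<close> of degree at most \<open>d\<close> and an affine subspace of dimension \<open>k\<close>. It
  is a graph over some set \<open>I\<close> of \<open>k\<close> coordinates, and even after all coefficients of \<open>f\<close> except
  those of monomials inside \<open>I\<close> are fixed, the \<open>t\<close>-th moment of the bias is at most that of a random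
  polynomial in the variables of \<open>I\<close>, by positive definiteness. Split \<open>I\<close> into \<open>Y\<close> and \<open>Z\<close> with
  \<open>|Z|\<close> about \<open>k / 4\<close> and randomize only \<open>\<Sum>j\<in>Z. z\<^sub>j p\<^sub>j(y)\<close> with \<open>p\<^sub>j\<close> of degree less than \<open>d\<close>. Averaging over
  \<open>z\<close>, the moment is the chance that all \<open>p\<^sub>j\<close> vanish at \<open>t\<close> random points \<open>y\<close>, that is
  \<open>2 ^ (- |Z| r)\<close> averaged over the points, where \<open>r\<close> is their rank with respect to polynomials of degree
  less than \<open>d\<close>. A set of \<open>2 ^ M\<close> points has rank at least \<open>M choose (d - 1)\<close>, so for \<open>t\<close> up to this size
  each new point raises the rank except with probability \<open>2 ^ (- k / 4)\<close>. The lower bound on \<open>k\<close>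
  allows \<open>t = 80 n\<close>, and Markov's inequality beats the roughly \<open>2 ^ (n k)\<close> affine subspaces, with the bias
  bound \<open>2 ^ (- k / 16)\<close>, which does not even need the division by \<open>d\<close>.
\<close>

section \<open>Counting numbers with few binary digits\<close>

fun digit_weight :: "nat \<Rightarrow> nat" where
  "digit_weight n = (if n = 0 then 0 else n mod 2 + digit_weight (n div 2))"

declare digit_weight.simps [simp del]

lemma digit_weight_0 [simp]: "digit_weight 0 = 0"
  by (simp add: digit_weight.simps)

lemma digit_weight_double [simp]: "digit_weight (2 * n) = digit_weight n"
  by (cases "n = 0") (simp_all add: digit_weight.simps[of "2 * n"])

lemma digit_weight_Suc_double [simp]: "digit_weight (Suc (2 * n)) = Suc (digit_weight n)"
  by (simp add: digit_weight.simps[of "Suc (2 * n)"])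

text \<open>
  The numbers below \<open>b\<close> stand for an initial segment of the cube: \<open>light 0 b e\<close> is the least dimension
  that the polynomials of degree less than \<open>e\<close> can have on a set of \<open>b\<close> points. The strict bound lets
  \<open>e = 0\<close> denote the zero space.
\<close>

definition light :: "nat \<Rightarrow> nat \<Rightarrow> nat \<Rightarrow> nat" where
  "light a b e = (\<Sum>i=a..<b. of_bool (digit_weight i < e))"

lemma light_refl [simp]: "light a a e = 0"
  and light_zero [simp]: "light a b 0 = 0"
  by (simp_all add: light_def)

lemma light_Suc: "a \<le> b \<Longrightarrow> light a (Suc b) e = light a b e + of_bool (digit_weight b < e)"
  by (simp add: light_def)

lemma light_append: "a \<le> b \<Longrightarrow> b \<le> c \<Longrightarrow> light a b e + light b c e = light a c e"
  unfolding light_def by (rule sum.atLeastLessThan_concat)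

lemma light_mono: "b \<le> c \<Longrightarrow> light 0 b e \<le> light 0 c e"
  unfolding light_def by (intro sum_mono2) auto

text \<open>\<open>2 * j\<close> has the weight of \<open>j\<close> and \<open>Suc (2 * j)\<close>
  one more. The halves of the even members run between the endpoints halved upwards, hence
  \<open>Suc a div 2\<close>; those of the odd members between the endpoints halved
  downwards.\<close>

lemma light_halve:
  assumes "a \<le> b"
  shows "light a b (Suc e) = light (Suc a div 2) (Suc b div 2) (Suc e) + light (a div 2) (b div 2) e"
  using assms
proof (induction b rule: dec_induct)
  case base
  then show ?case by simp
next
  case (step b)
  have le: "Suc a div 2 \<le> Suc b div 2" "a div 2 \<le> b div 2"
    using step.hyps by (simp_all add: div_le_mono)
  show ?case
  proof (cases "even b")
    case True
    then obtain j where j: "b = 2 * j" by (rule evenE)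
    then show ?thesis
      using step le by (simp add: light_Suc)
  next
    case False
    then obtain j where j: "b = Suc (2 * j)" by (metis oddE Suc_eq_plus1)
    then show ?thesis
      using step le by (simp add: light_Suc)
  qed
qed

text \<open>
  Halve both intervals: even and odd members reduce to shifted intervals of half the length. Only
  \<open>a = b\<close> odd violates \<open>b \<le> a\<close> after halving, and there one endpoint is split off by hand.
\<close>

lemma light_shift: "b \<le> a \<Longrightarrow> light a (a + b) (Suc e) \<le> light 0 b e"
proof (induction a arbitrary: b e rule: less_induct)
  case (less a)
  \<comment> \<open>For \<open>a = 1\<close> the upward half of \<open>a\<close> is 1 again, so the
    induction hypothesis is usable only from \<open>a = 2\<close> on.\<close>
  consider "b = 0" | "a = 1" "b = 1" | "2 \<le> a" "0 < b"
    using less.prems by linarith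
  then show ?case
  proof cases
    case 1
    then show ?thesis by simp
  next
    case 2
    have "digit_weight (Suc 0) = Suc 0" using digit_weight_Suc_double[of 0] by simp
    with 2 show ?thesis by (simp add: light_def)
  next
    case 3
    have split: "light a (a + b) (Suc e)
        = light (Suc a div 2) (Suc (a + b) div 2) (Suc e) + light (a div 2) ((a + b) div 2) e"
      by (rule light_halve) simp
    have target: "light 0 b (Suc e') = light 0 (Suc b div 2) (Suc e') + light 0 (b div 2) e'" for e'
      using light_halve[of 0 b e'] by simp
    have IH: "light p r (Suc e') \<le> light 0 q e'" if "p < a" "q \<le> p" "r = p + q" for p q r e'
      using less.IH that by simp
    show ?thesis
    proof (cases "even a")
      case True
      then obtain p where p: "a = 2 * p" by (rule evenE)
      have r: "Suc (a + b) div 2 = p + Suc b div 2" "(a + b) div 2 = p + b div 2" "Suc a div 2 = p" "a div 2 = p"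
        using p by auto
      have le: "p < a" "Suc b div 2 \<le> p" "b div 2 \<le> p"
        using p 3 less.prems by auto
      show ?thesis
      proof (cases e)
        case 0
        then show ?thesis unfolding split using IH[of p "Suc b div 2" _ 0] r le by simp
      next
        case (Suc e')
        then show ?thesis unfolding split unfolding Suc unfolding target
          using IH[of p "Suc b div 2" _ "Suc e'"] IH[of p "b div 2" _ e'] r le by (simp add: add_mono)
      qed
    next
      case False
      then obtain p where p: "a = Suc (2 * p)" by (metis oddE Suc_eq_plus1)
      have r: "Suc (a + b) div 2 = Suc p + b div 2" "(a + b) div 2 = p + Suc b div 2"
          "Suc a div 2 = Suc p" "a div 2 = p"
        using p by auto
      have le: "Suc p < a" "b div 2 \<le> Suc p" "b div 2 \<le> p"
        using p 3 less.prems by auto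
      have evens: "light (Suc a div 2) (Suc (a + b) div 2) (Suc e) \<le> light 0 (b div 2) e"
        using IH[of "Suc p" "b div 2" _ e] r le by simp
      show ?thesis
      proof (cases e)
        case 0
        then show ?thesis unfolding split using evens by simp
      next
        case (Suc e')
        \<comment> \<open>For odd \<open>a\<close> and odd \<open>b\<close> the two halves have
          their lengths the wrong way round compared with \<open>target\<close>: the even members
          form the shorter interval. The bound for the even members is therefore added on the left,
          and the two parts are compared together.\<close>
        have odds: "light p (p + Suc b div 2) (Suc e') + light 0 (b div 2) (Suc e')
            \<le> light 0 (b div 2) e' + light 0 (Suc b div 2) (Suc e')"
        proof (cases "even b")
          case True
          then obtain q where q: "b = 2 * q" by (rule evenE)
          show ?thesis using IH[of p q _ e'] le q by simp
        next
          case False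
          then obtain q where q: "b = Suc (2 * q)" by (metis oddE Suc_eq_plus1)
          show ?thesis
          proof (cases "q = p")
            case True
            have "light p (p + Suc p) (Suc e') = of_bool (digit_weight p < Suc e') + light (Suc p) (Suc p + p) (Suc e')"
              using light_append[of p "Suc p" "p + Suc p" "Suc e'"] light_Suc[of p p "Suc e'"] by simp
            moreover have "light (Suc p) (Suc p + p) (Suc e') \<le> light 0 p e'"
              by (rule IH) (use le in auto)
            ultimately show ?thesis using q True by (simp add: light_Suc)
          next
            case False
            then have "light p (p + Suc q) (Suc e') \<le> light 0 (Suc q) e'"
              using IH[of p "Suc q" _ e'] le q by simp
            moreover have "(of_bool (digit_weight q < e') :: nat) \<le> of_bool (digit_weight q < Suc e')"
              by simp
            ultimately show ?thesis using q by (simp add: light_Suc del: of_bool_less_eq_iff)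
          qed
        qed
        then show ?thesis unfolding split unfolding Suc unfolding target using evens r Suc by simp
      qed
    qed
  qed
qed

text \<open>The form needed for point sets: \<open>a\<close> and \<open>b\<close> become the sizes
  of the union and the intersection of two halves of a set, which is why \<open>b \<le> a\<close>
  holds there.\<close>

lemma light_add: "b \<le> a \<Longrightarrow> light 0 (a + b) (Suc e) \<le> light 0 a (Suc e) + light 0 b e"
  using light_shift[of b a e] light_append[of 0 a "a + b" "Suc e"] by simp

text \<open>Halving the interval up to a power of two gives Pascal's recursion. The exact count sums
  all binomials up to \<open>e\<close>; the last one suffices.\<close>

lemma binomial_le_light: "M choose e \<le> light 0 (2 ^ M) (Suc e)"
proof (induction M arbitrary: e)
  case 0
  then show ?case by (cases e) (simp_all add: light_def)
next
  case (Suc M)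
  have "light 0 (2 ^ Suc M) (Suc e) = light 0 (2 ^ M) (Suc e) + light 0 (2 ^ M) e"
    using light_halve[of 0 "2 ^ Suc M" e] by simp
  then show ?case
    using Suc.IH[of e] Suc.IH[of "e - 1"] by (cases e) auto
qed

section \<open>Polynomials vanishing on a set of points\<close>

text \<open>
  A point of the cube is the set \<open>x\<close> of its nonzero coordinates and a polynomial the set \<open>A\<close> of its
  monomials, so \<open>chi A x\<close> is \<open>(-1) ^ A(x)\<close> and addition of polynomials is symmetric difference.
\<close>

definition chi :: "'a set set \<Rightarrow> 'a set \<Rightarrow> real" where
  "chi A x = (\<Prod>S\<in>A. if S \<subseteq> x then -1 else 1)"

lemma chi_cases: "chi A x = 1 \<or> chi A x = -1"
  unfolding chi_def by (induction A rule: infinite_finite_induct) auto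

lemma abs_chi [simp]: "\<bar>chi A x\<bar> = 1"
  using chi_cases[of A x] by auto

lemma chi_mult_self [simp]: "chi A x * chi A x = 1"
  using chi_cases[of A x] by auto

lemma chi_union: "finite A \<Longrightarrow> finite B \<Longrightarrow> A \<inter> B = {} \<Longrightarrow> chi (A \<union> B) x = chi A x * chi B x"
  unfolding chi_def by (rule prod.union_disjoint)

lemma chi_cong: "(\<And>S. S \<in> A \<Longrightarrow> S \<subseteq> x \<longleftrightarrow> S \<subseteq> y) \<Longrightarrow> chi A x = chi A y"
  unfolding chi_def by (intro prod.cong) auto

lemma chi_sym_diff:
  assumes "finite A" "finite B"
  shows "chi ((A - B) \<union> (B - A)) x = chi A x * chi B x"
proof -
  have "chi A x = chi (A - B) x * chi (A \<inter> B) x" "chi B x = chi (B - A) x * chi (A \<inter> B) x"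
    using assms by (subst chi_union[symmetric]; auto intro: arg_cong[where f = "\<lambda>A. chi A x"])+
  moreover have "chi ((A - B) \<union> (B - A)) x = chi (A - B) x * chi (B - A) x"
    using assms by (intro chi_union) auto
  ultimately show ?thesis
    using chi_cases[of "A \<inter> B" x] by auto
qed

lemma chi_image_insert:
  assumes "\<And>S. S \<in> A \<Longrightarrow> y \<notin> S"
  shows "chi (insert y ` A) x = (if y \<in> x then chi A x else 1)"
proof -
  have "inj_on (insert y) A"
    using assms by (auto intro!: inj_onI dest: insert_ident)
  then show ?thesis
    unfolding chi_def by (simp add: prod.reindex)
qed

definition monomials :: "'a set \<Rightarrow> nat \<Rightarrow> 'a set set" where
  "monomials Y e = {S. S \<subseteq> Y \<and> card S < e}"

lemma finite_monomials [simp]: "finite Y \<Longrightarrow> finite (monomials Y e)"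
  by (simp add: monomials_def)

lemma monomials_0 [simp]: "monomials Y 0 = {}"
  by (simp add: monomials_def)

lemma monomials_insert:
  assumes "finite Y" "y \<notin> Y"
  shows "monomials (insert y Y) (Suc e) = monomials Y (Suc e) \<union> insert y ` monomials Y e"
proof (intro equalityI subsetI)
  fix S assume S: "S \<in> monomials (insert y Y) (Suc e)"
  show "S \<in> monomials Y (Suc e) \<union> insert y ` monomials Y e"
  proof (cases "y \<in> S")
    case True
    have "finite S" using S assms finite_subset unfolding monomials_def by blast
    then have "card (S - {y}) < e" using S True unfolding monomials_def
      by (metis (no_types, lifting) card.remove mem_Collect_eq Suc_less_eq)
    then have "S - {y} \<in> monomials Y e" using S unfolding monomials_def by auto
    then show ?thesis using True by (metis UnI2 imageI insert_Diff)
  next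
    case False
    then show ?thesis using S unfolding monomials_def by auto
  qed
next
  fix S assume S: "S \<in> monomials Y (Suc e) \<union> insert y ` monomials Y e"
  then show "S \<in> monomials (insert y Y) (Suc e)"
  proof
    assume "S \<in> insert y ` monomials Y e"
    then obtain T where T: "S = insert y T" "T \<subseteq> Y" "card T < e" unfolding monomials_def by auto
    have "finite T" "y \<notin> T" using T assms finite_subset by blast+
    then show ?thesis using T unfolding monomials_def by auto
  qed (auto simp: monomials_def)
qed

lemma card_monomials_insert:
  assumes "finite Y" "y \<notin> Y"
  shows "card (monomials (insert y Y) (Suc e)) = card (monomials Y (Suc e)) + card (monomials Y e)"
proof -
  have "inj_on (insert y) (monomials Y e)"
    using assms by (auto intro!: inj_onI simp: monomials_def)
  moreover have "monomials Y (Suc e) \<inter> insert y ` monomials Y e = {}"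
    using assms by (auto simp: monomials_def)
  ultimately show ?thesis
    using assms by (simp add: monomials_insert card_Un_disjoint card_image)
qed

definition vanishing :: "'a set \<Rightarrow> nat \<Rightarrow> 'a set set \<Rightarrow> 'a set set set" where
  "vanishing Y e P = {A. A \<subseteq> monomials Y e \<and> (\<forall>x\<in>P. chi A x = 1)}"

lemma finite_vanishing [simp]: "finite Y \<Longrightarrow> finite (vanishing Y e P)"
  by (simp add: vanishing_def)

text \<open>
  Write a polynomial as \<open>p + y q\<close>. It vanishes on \<open>P\<close> iff \<open>p = 0\<close> on \<open>P0\<close> and \<open>p = q\<close> on \<open>P1\<close>. Hence \<open>q\<close>
  vanishes on \<open>P0 \<inter> P1\<close>, and for fixed \<open>q\<close> the \<open>p\<close> form a coset of those vanishing on \<open>P0 \<union> P1\<close>.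
\<close>

lemma card_vanishing_insert:
  assumes Y: "finite Y" "y \<notin> Y" and P: "P \<subseteq> Pow (insert y Y)"
  defines "P0 \<equiv> {x\<in>P. y \<notin> x}" and "P1 \<equiv> (\<lambda>x. x - {y}) ` {x\<in>P. y \<in> x}"
  shows "card (vanishing (insert y Y) (Suc e) P)
    \<le> card (vanishing Y (Suc e) (P0 \<union> P1)) * card (vanishing Y e (P0 \<inter> P1))"
proof -
  define C where "C q = {p. p \<subseteq> monomials Y (Suc e) \<and> (\<forall>x\<in>P0. chi p x = 1) \<and> (\<forall>x\<in>P1. chi p x = chi q x)}" for q
  have fin: "finite (monomials Y e')" for e' using Y by simp
  have finC: "finite (C q)" for q
    unfolding C_def using fin[of "Suc e"] by simp
  have y_notin: "y \<notin> S" if "S \<in> monomials Y e'" for S e'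
    using that Y by (auto simp: monomials_def)
  have sub: "vanishing (insert y Y) (Suc e) P
      \<subseteq> (\<lambda>(q, p). p \<union> insert y ` q) ` (SIGMA q:vanishing Y e (P0 \<inter> P1). C q)"
  proof
    fix A assume A: "A \<in> vanishing (insert y Y) (Suc e) P"
    define p where "p = A \<inter> monomials Y (Suc e)"
    define q where "q = {S \<in> monomials Y e. insert y S \<in> A}"
    have Ap: "A = p \<union> insert y ` q"
      using A unfolding vanishing_def monomials_insert[OF Y] p_def q_def by auto
    have finpq: "finite p" "finite q" using fin unfolding p_def q_def by auto
    have yp: "y \<notin> S" if "S \<in> p" for S using that y_notin unfolding p_def by auto
    have yq: "y \<notin> S" if "S \<in> q" for S using that y_notin unfolding q_def by auto
    have chiA: "chi A x = chi p x * (if y \<in> x then chi q x else 1)" for x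
      unfolding Ap using finpq yp by (subst chi_union) (auto simp: chi_image_insert yq)
    have c0: "chi p x = 1" if "x \<in> P0" for x
      using that A chiA[of x] unfolding P0_def vanishing_def by simp
    have c1: "chi p x = chi q x" if "x \<in> P1" for x
    proof -
      obtain z where z: "z \<in> P" "y \<in> z" "x = z - {y}" using \<open>x \<in> P1\<close> unfolding P1_def by auto
      have "chi p z * chi q z = 1" using A chiA[of z] z unfolding vanishing_def by simp
      moreover have "chi p x = chi p z" "chi q x = chi q z"
        using yp yq z by (auto intro!: chi_cong)
      ultimately show ?thesis using chi_cases[of p z] chi_cases[of q z] by auto
    qed
    have "chi q x = 1" if "x \<in> P0 \<inter> P1" for x
      using c0[of x] c1[of x] that by simp
    then have "q \<in> vanishing Y e (P0 \<inter> P1)"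
      unfolding vanishing_def using q_def by blast
    moreover have "p \<in> C q" using c0 c1 unfolding C_def p_def by auto
    ultimately show "A \<in> (\<lambda>(q, p). p \<union> insert y ` q) ` (SIGMA q:vanishing Y e (P0 \<inter> P1). C q)"
      using Ap by force
  qed
  have Cq: "card (C q) \<le> card (vanishing Y (Suc e) (P0 \<union> P1))" for q
  proof (cases "C q = {}")
    case False
    then obtain p0 where p0: "p0 \<in> C q" by auto
    let ?f = "\<lambda>p. (p - p0) \<union> (p0 - p)"
    show ?thesis
    proof (rule card_inj_on_le[where f = ?f])
      show "inj_on ?f (C q)" by (auto intro!: inj_onI)
      have "?f p \<in> vanishing Y (Suc e) (P0 \<union> P1)" if p: "p \<in> C q" for p
      proof -
        have "finite p" "finite p0" using p p0 fin finite_subset unfolding C_def by blast+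
        then show ?thesis using p p0 unfolding C_def vanishing_def by (auto simp: chi_sym_diff)
      qed
      then show "?f ` C q \<subseteq> vanishing Y (Suc e) (P0 \<union> P1)" by auto
      show "finite (vanishing Y (Suc e) (P0 \<union> P1))" using Y by simp
    qed
  qed simp
  have fS: "finite (SIGMA q:vanishing Y e (P0 \<inter> P1). C q)"
    using Y finC by simp
  have "card (vanishing (insert y Y) (Suc e) P) \<le> card (SIGMA q:vanishing Y e (P0 \<inter> P1). C q)"
    using card_mono[OF finite_imageI[OF fS] sub] card_image_le[OF fS] by (rule order_trans)
  also have "\<dots> = (\<Sum>q\<in>vanishing Y e (P0 \<inter> P1). card (C q))"
    using Y finC by (intro card_SigmaI) auto
  also have "\<dots> \<le> (\<Sum>q\<in>vanishing Y e (P0 \<inter> P1). card (vanishing Y (Suc e) (P0 \<union> P1)))"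
    by (intro sum_mono Cq)
  finally show ?thesis by (simp add: mult.commute)
qed

text \<open>Evaluation at the points of \<open>P\<close> has rank at least
  \<open>light 0 (card P) e\<close>. In the induction over the variables,
  \<open>card_vanishing_insert\<close> splits the count into one factor for the union and one for
  the intersection of the two halves of \<open>P\<close>. Their sizes add up to
  \<open>card P\<close>, and \<open>light_add\<close> matches the exponents.\<close>

lemma card_vanishing:
  assumes "finite Y" "P \<subseteq> Pow Y"
  shows "card (vanishing Y e P) * 2 ^ light 0 (card P) e \<le> 2 ^ card (monomials Y e)"
  using assms
proof (induction Y arbitrary: P e rule: finite_induct)
  case empty
  show ?case
  proof (cases e)
    case 0
    have "card (vanishing {} 0 P) \<le> card {{} :: 'a set set}"
      by (rule card_mono) (auto simp: vanishing_def)
    with 0 show ?thesis by simp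
  next
    case (Suc e')
    have m: "monomials {} e = {{} :: 'a set}" using Suc by (auto simp: monomials_def)
    show ?thesis
    proof (cases "P = {}")
      case True
      have "card (vanishing {} e P) \<le> card (Pow {{} :: 'a set})"
        by (rule card_mono) (auto simp: vanishing_def m)
      then show ?thesis using True m by (simp add: card_Pow)
    next
      case False
      then have P: "P = {{}}" using empty by auto
      have "card (vanishing {} e P) \<le> card {{} :: 'a set set}"
        by (rule card_mono) (auto simp: vanishing_def m P subset_singleton_iff chi_def)
      then show ?thesis using P m Suc by (simp add: light_def)
    qed
  qed
next
  case (insert y Y)
  show ?case
  proof (cases e)
    case 0
    have "card (vanishing (insert y Y) 0 P) \<le> card {{} :: 'a set set}"
      by (rule card_mono) (auto simp: vanishing_def)
    with 0 show ?thesis by simp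
  next
    case (Suc e')
    define P0 where "P0 = {x\<in>P. y \<notin> x}"
    define P1 where "P1 = (\<lambda>x. x - {y}) ` {x\<in>P. y \<in> x}"
    have sub: "P0 \<subseteq> Pow Y" "P1 \<subseteq> Pow Y" using insert.prems unfolding P0_def P1_def by auto
    have fin: "finite P" using insert finite_subset by (metis finite.insertI finite_Pow_iff)
    have fin01: "finite P0" "finite P1" using fin unfolding P0_def P1_def by auto
    have "card P1 = card {x\<in>P. y \<in> x}"
      unfolding P1_def by (intro card_image inj_onI) blast
    moreover have "card P = card P0 + card {x\<in>P. y \<in> x}"
      unfolding P0_def using fin by (subst card_Un_disjoint[symmetric]) (auto intro: arg_cong[where f = card])
    ultimately have "card P = card (P0 \<union> P1) + card (P0 \<inter> P1)"
      using card_Un_Int[OF fin01] by simp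
    moreover have "card (P0 \<inter> P1) \<le> card (P0 \<union> P1)"
      using fin01 by (intro card_mono) auto
    ultimately have l: "light 0 (card P) e \<le> light 0 (card (P0 \<union> P1)) e + light 0 (card (P0 \<inter> P1)) e'"
      using light_add Suc by simp
    have "card (vanishing (insert y Y) e P) * 2 ^ light 0 (card P) e
        \<le> (card (vanishing Y e (P0 \<union> P1)) * card (vanishing Y e' (P0 \<inter> P1)))
          * 2 ^ (light 0 (card (P0 \<union> P1)) e + light 0 (card (P0 \<inter> P1)) e')"
      using card_vanishing_insert[OF insert.hyps insert.prems, of e'] l Suc
      unfolding P0_def P1_def by (intro mult_mono power_increasing) auto
    also have "\<dots> = (card (vanishing Y e (P0 \<union> P1)) * 2 ^ light 0 (card (P0 \<union> P1)) e)
        * (card (vanishing Y e' (P0 \<inter> P1)) * 2 ^ light 0 (card (P0 \<inter> P1)) e')"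
      by (simp add: power_add)
    also have "\<dots> \<le> 2 ^ card (monomials Y e) * 2 ^ card (monomials Y e')"
      using sub by (intro mult_mono insert.IH) auto
    also have "\<dots> = 2 ^ card (monomials (insert y Y) e)"
      using insert.hyps Suc by (simp add: card_monomials_insert power_add)
    finally show ?thesis .
  qed
qed

section \<open>Moments of random character sums\<close>

text \<open>
  The sign \<open>\<sigma>\<close> is only there for the induction: each factor of the power multiplies it by a character.
  At \<open>t = 0\<close> the sum is \<open>\<Prod>(1 + \<sigma> S) \<ge> 0\<close>, which is why dropping \<open>g\<close> can only increase the moment.
\<close>

lemma abs_twisted_moment_le:
  fixes \<sigma> :: "'a set \<Rightarrow> real"
  assumes "finite F" "\<And>S. \<bar>\<sigma> S\<bar> \<le> 1" "\<And>x. \<bar>g x\<bar> \<le> 1"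
  shows "\<bar>\<Sum>A\<in>Pow F. (\<Prod>S\<in>A. \<sigma> S) * (\<Sum>x\<in>B. g x * chi A x) ^ t\<bar>
    \<le> (\<Sum>A\<in>Pow F. (\<Prod>S\<in>A. \<sigma> S) * (\<Sum>x\<in>B. chi A x) ^ t)"
  using assms(2)
proof (induction t arbitrary: \<sigma>)
  case 0
  have "0 \<le> \<sigma> S + 1" for S using 0[of S] by linarith
  then have "0 \<le> (\<Prod>S\<in>F. \<sigma> S + 1)"
    by (intro prod_nonneg)
  also have "\<dots> = (\<Sum>A\<in>Pow F. \<Prod>S\<in>A. \<sigma> S)"
    using assms(1) by (simp add: prod_add)
  finally show ?case by simp
next
  case (Suc t)
  define \<tau> where "\<tau> x S = \<sigma> S * (if S \<subseteq> x then -1 else 1)" for x S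
  have \<tau>: "(\<Prod>S\<in>A. \<sigma> S) * chi A x = (\<Prod>S\<in>A. \<tau> x S)" for A x
    unfolding \<tau>_def chi_def by (simp add: prod.distrib)
  have expand: "(\<Sum>A\<in>Pow F. (\<Prod>S\<in>A. \<sigma> S) * (\<Sum>x\<in>B. h x * chi A x) ^ Suc t)
      = (\<Sum>x\<in>B. h x * (\<Sum>A\<in>Pow F. (\<Prod>S\<in>A. \<tau> x S) * (\<Sum>x\<in>B. h x * chi A x) ^ t))" for h :: "'a set \<Rightarrow> real"
  proof -
    have "(\<Sum>x\<in>B. h x * (\<Sum>A\<in>Pow F. (\<Prod>S\<in>A. \<tau> x S) * (\<Sum>x\<in>B. h x * chi A x) ^ t))
      = (\<Sum>x\<in>B. \<Sum>A\<in>Pow F. (\<Prod>S\<in>A. \<sigma> S) * (h x * chi A x) * (\<Sum>x\<in>B. h x * chi A x) ^ t)"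
      by (simp add: \<tau>[symmetric] sum_distrib_left mult_ac)
    also have "\<dots> = (\<Sum>A\<in>Pow F. \<Sum>x\<in>B. (\<Prod>S\<in>A. \<sigma> S) * (h x * chi A x) * (\<Sum>x\<in>B. h x * chi A x) ^ t)"
      by (rule sum.swap)
    finally show ?thesis
      by (simp add: sum_distrib_left sum_distrib_right mult_ac)
  qed
  have "\<bar>\<tau> x S\<bar> \<le> 1" for x S
    using Suc.prems[of S] unfolding \<tau>_def by (simp add: abs_mult)
  note IH = Suc.IH[OF this]
  have "\<bar>\<Sum>A\<in>Pow F. (\<Prod>S\<in>A. \<sigma> S) * (\<Sum>x\<in>B. g x * chi A x) ^ Suc t\<bar>
      \<le> (\<Sum>x\<in>B. \<bar>g x\<bar> * \<bar>\<Sum>A\<in>Pow F. (\<Prod>S\<in>A. \<tau> x S) * (\<Sum>x\<in>B. g x * chi A x) ^ t\<bar>)"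
    unfolding expand by (rule order_trans[OF sum_abs]) (simp add: abs_mult)
  also have "\<dots> \<le> (\<Sum>x\<in>B. 1 * (\<Sum>A\<in>Pow F. (\<Prod>S\<in>A. \<tau> x S) * (\<Sum>x\<in>B. chi A x) ^ t))"
    using IH assms(3) by (intro sum_mono mult_mono) auto
  also have "\<dots> = (\<Sum>A\<in>Pow F. (\<Prod>S\<in>A. \<sigma> S) * (\<Sum>x\<in>B. chi A x) ^ Suc t)"
    using expand[of "\<lambda>_. 1"] by simp
  finally show ?case .
qed

text \<open>The weight \<open>g\<close> will be the character of the part of the polynomial that is
  held fixed. The sign of the previous lemma starts out trivial.\<close>

lemma moment_le:
  fixes g :: "'a set \<Rightarrow> real"
  assumes "finite F" "\<And>x. \<bar>g x\<bar> \<le> 1"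
  shows "(\<Sum>A\<in>Pow F. (\<Sum>x\<in>B. g x * chi A x) ^ t) \<le> (\<Sum>A\<in>Pow F. (\<Sum>x\<in>B. chi A x) ^ t)"
  using abs_twisted_moment_le[of F "\<lambda>_. 1" g B t] assms by simp

text \<open>
  The \<open>t\<close>-th power counts \<open>t\<close>-tuples of common zeros. Adding a point \<open>y\<close> halves \<open>V\<close> unless all of \<open>V\<close>
  vanishes at \<open>y\<close>; while \<open>V\<close> is large, this happens for at most a \<open>2 ^ (- s)\<close> fraction of the points.
\<close>

lemma common_zero_moment_le:
  fixes Y Z :: "'a set"
  assumes Y: "finite Y" and Z: "finite Z" and s: "s \<le> card Y"
    and V: "V \<subseteq> Pow (monomials Y d)" "\<And>A B. A \<in> V \<Longrightarrow> B \<in> V \<Longrightarrow> (A - B) \<union> (B - A) \<in> V"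
  shows "(\<Sum>\<alpha>\<in>Z \<rightarrow>\<^sub>E V. real (card {y \<in> Pow Y. \<forall>j\<in>Z. chi (\<alpha> j) y = 1}) ^ t)
    \<le> (2 ^ card Y) ^ t * (real (card V) ^ card Z * ((1/2) ^ s + (1/2) ^ card Z) ^ t
      + (2 ^ card (monomials Y d) / 2 ^ light 0 (2 ^ (card Y - s)) d) ^ card Z)"
  using V
proof (induction t arbitrary: V)
  case 0
  have "finite V" using 0 Y finite_subset by (metis finite_Pow_iff finite_monomials)
  then show ?case using Z by (simp add: card_PiE)
next
  case (Suc t)
  let ?L = "2 ^ card Y :: real" and ?m = "card Z"
  let ?q = "(1/2) ^ s + (1/2) ^ ?m :: real"
  let ?N = "2 ^ card (monomials Y d) :: real" and ?H = "light 0 (2 ^ (card Y - s)) d"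
  define K where "K = (?N / 2 ^ ?H) ^ ?m"
  define c where "c \<alpha> = card {y \<in> Pow Y. \<forall>j\<in>Z. chi (\<alpha> j) y = 1}" for \<alpha> :: "'a \<Rightarrow> 'a set set"
  define W where "W y = {A\<in>V. chi A y = 1}" for y
  have finV: "finite V" using Suc.prems Y finite_subset by (metis finite_Pow_iff finite_monomials)
  have finA: "finite A" if "A \<in> V" for A using that Suc.prems Y finite_subset by (metis PowD finite_monomials subsetD)
  have K0: "0 \<le> K" unfolding K_def by simp
  have c_le: "real (c \<alpha>) \<le> ?L" for \<alpha>
  proof -
    have "c \<alpha> \<le> card (Pow Y)" unfolding c_def using Y by (intro card_mono) auto
    then have "real (c \<alpha>) \<le> real (2 ^ card Y)" using Y by (simp only: card_Pow of_nat_le_iff)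
    then show ?thesis by simp
  qed
  show ?case
  \<comment> \<open>Once \<open>V\<close> is this small, counting all \<open>2 ^ card Y\<close>
    points for every family costs only the term \<open>K\<close>. It does not depend on
    \<open>V\<close>, so it passes through the induction unchanged.\<close>
  proof (cases "real (card V) \<le> ?N / 2 ^ ?H")
    case True
    have "(\<Sum>\<alpha>\<in>Z \<rightarrow>\<^sub>E V. real (c \<alpha>) ^ Suc t) \<le> (\<Sum>\<alpha>\<in>Z \<rightarrow>\<^sub>E V. ?L ^ Suc t)"
      by (intro sum_mono power_mono c_le) simp
    also have "\<dots> = ?L ^ Suc t * real (card V) ^ ?m"
      using Z finV by (simp add: card_PiE)
    also have "\<dots> \<le> ?L ^ Suc t * K"
      unfolding K_def using True by (intro mult_left_mono power_mono) auto
    also have "\<dots> \<le> ?L ^ Suc t * (real (card V) ^ ?m * ?q ^ Suc t + K)"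
      by (intro mult_left_mono) simp_all
    finally show ?thesis unfolding c_def K_def .
  next
    case False
    \<comment> \<open>The points that do not cut \<open>V\<close> down. If there were
      \<open>2 ^ (card Y - s)\<close> of them, \<open>card_vanishing\<close> would push
      \<open>V\<close> below the threshold excluded here, so they make up at most a
      \<open>2 ^ (- s)\<close> fraction.\<close>
    define P where "P = {y\<in>Pow Y. \<forall>A\<in>V. chi A y = 1}"
    have finP: "finite P" "P \<subseteq> Pow Y" unfolding P_def using Y by auto
    have "V \<subseteq> vanishing Y d P" using Suc.prems unfolding vanishing_def P_def by auto
    then have "card V \<le> card (vanishing Y d P)" using Y by (intro card_mono) auto
    then have "card V * 2 ^ light 0 (card P) d \<le> card (vanishing Y d P) * 2 ^ light 0 (card P) d"
      by simp
    also have "\<dots> \<le> 2 ^ card (monomials Y d)"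
      using card_vanishing[OF Y finP(2)] .
    finally have "real (card V * 2 ^ light 0 (card P) d) \<le> real (2 ^ card (monomials Y d))"
      by (simp only: of_nat_le_iff)
    then have "real (card V) * 2 ^ light 0 (card P) d \<le> ?N" by simp
    also have "?N < real (card V) * 2 ^ ?H" using False by (simp add: field_simps)
    finally have "(2::real) ^ light 0 (card P) d < 2 ^ ?H"
      by (simp add: mult_less_cancel_left)
    then have "light 0 (card P) d < ?H" by simp
    then have "card P < 2 ^ (card Y - s)"
      using light_mono[of "2 ^ (card Y - s)" "card P" d] by linarith
    then have "real (card P) < real (2 ^ (card Y - s))" by (simp only: of_nat_less_iff)
    also have "\<dots> = 2 ^ (card Y - s)" by simp
    also have "\<dots> = ?L * (1/2) ^ s"
      using s by (subst power_diff) (simp_all add: power_one_over)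
    finally have cardP: "real (card P) \<le> ?L * (1/2) ^ s" by simp
    have W_half: "real (card (W y)) \<le> real (card V) / 2" if y: "y \<in> Pow Y - P" for y
    proof -
      obtain A0 where A0: "A0 \<in> V" "chi A0 y = -1"
        using y chi_cases unfolding P_def by blast
      \<comment> \<open>Adding a member \<open>A0\<close> that is nonzero at \<open>y\<close> moves
        \<open>W y\<close> injectively into its complement in \<open>V\<close>.\<close>
      have "card (W y) \<le> card (V - W y)"
      proof (rule card_inj_on_le[where f = "\<lambda>A. (A - A0) \<union> (A0 - A)"])
        show "inj_on (\<lambda>A. (A - A0) \<union> (A0 - A)) (W y)" by (auto intro!: inj_onI)
        show "(\<lambda>A. (A - A0) \<union> (A0 - A)) ` W y \<subseteq> V - W y"
          using Suc.prems(2) A0 finA by (auto simp: W_def chi_sym_diff)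
        show "finite (V - W y)" using finV by simp
      qed
      also have "\<dots> = card V - card (W y)"
        using finV by (intro card_Diff_subset) (auto simp: W_def)
      finally have "2 * card (W y) \<le> card V"
        using card_mono[OF finV, of "W y"] unfolding W_def by auto
      then show ?thesis by linarith
    qed
    have W_le: "real (card (W y)) \<le> real (card V)" for y
      using finV by (auto intro!: card_mono simp: W_def)
    have sumW: "(\<Sum>y\<in>Pow Y. real (card (W y)) ^ ?m) \<le> ?L * (real (card V) ^ ?m * ?q)"
    proof -
      have "(\<Sum>y\<in>Pow Y. real (card (W y)) ^ ?m)
          = (\<Sum>y\<in>P. real (card (W y)) ^ ?m) + (\<Sum>y\<in>Pow Y - P. real (card (W y)) ^ ?m)"
        using sum.subset_diff[OF finP(2)] Y by (simp add: add.commute)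
      also have "\<dots> \<le> (\<Sum>y\<in>P. real (card V) ^ ?m) + (\<Sum>y\<in>Pow Y - P. (real (card V) / 2) ^ ?m)"
        using W_le W_half by (intro add_mono sum_mono power_mono) auto
      also have "\<dots> \<le> (\<Sum>y\<in>P. real (card V) ^ ?m) + (\<Sum>y\<in>Pow Y. (real (card V) / 2) ^ ?m)"
        using Y by (intro add_left_mono sum_mono2) auto
      also have "\<dots> = real (card P) * real (card V) ^ ?m + ?L * (real (card V) ^ ?m * (1/2) ^ ?m)"
        using Y by (simp add: card_Pow power_divide)
      also have "\<dots> \<le> (?L * (1/2) ^ s) * real (card V) ^ ?m + ?L * (real (card V) ^ ?m * (1/2) ^ ?m)"
        using cardP by (intro add_right_mono mult_right_mono) auto
      finally show ?thesis by (simp add: algebra_simps)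
    qed
    have fin: "finite (Z \<rightarrow>\<^sub>E V)" using Z finV by (intro finite_PiE) auto
    have PiE_W: "{\<alpha> \<in> Z \<rightarrow>\<^sub>E V. \<forall>j\<in>Z. chi (\<alpha> j) y = 1} = Z \<rightarrow>\<^sub>E W y" for y
      unfolding W_def by (auto simp: PiE_def Pi_def)
    \<comment> \<open>One factor of the power is spent on choosing a point \<open>y\<close>. The
      families vanishing there are those with values in \<open>W y\<close>, which is again closed
      under symmetric difference, so the induction hypothesis applies to \<open>W y\<close>.\<close>
    have "(\<Sum>\<alpha>\<in>Z \<rightarrow>\<^sub>E V. real (c \<alpha>) ^ Suc t)
        = (\<Sum>\<alpha>\<in>Z \<rightarrow>\<^sub>E V. \<Sum>y\<in>Pow Y. if \<forall>j\<in>Z. chi (\<alpha> j) y = 1 then real (c \<alpha>) ^ t else 0)"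
    proof (intro sum.cong refl)
      fix \<alpha> :: "'a \<Rightarrow> 'a set set"
      have "(\<Sum>y\<in>Pow Y. if \<forall>j\<in>Z. chi (\<alpha> j) y = 1 then real (c \<alpha>) ^ t else 0)
          = (\<Sum>y\<in>{y \<in> Pow Y. \<forall>j\<in>Z. chi (\<alpha> j) y = 1}. real (c \<alpha>) ^ t)"
        using Y by (intro sum.inter_filter[symmetric]) simp
      then show "real (c \<alpha>) ^ Suc t = (\<Sum>y\<in>Pow Y. if \<forall>j\<in>Z. chi (\<alpha> j) y = 1 then real (c \<alpha>) ^ t else 0)"
        by (simp only: sum_constant c_def[symmetric] power_Suc)
    qed
    also have "\<dots> = (\<Sum>y\<in>Pow Y. \<Sum>\<alpha>\<in>Z \<rightarrow>\<^sub>E V. if \<forall>j\<in>Z. chi (\<alpha> j) y = 1 then real (c \<alpha>) ^ t else 0)"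
      by (rule sum.swap)
    also have "\<dots> = (\<Sum>y\<in>Pow Y. \<Sum>\<alpha>\<in>Z \<rightarrow>\<^sub>E W y. real (c \<alpha>) ^ t)"
      unfolding PiE_W[symmetric] using fin by (intro sum.cong refl sum.inter_filter[symmetric])
    also have "\<dots> \<le> (\<Sum>y\<in>Pow Y. ?L ^ t * (real (card (W y)) ^ ?m * ?q ^ t + K))"
    proof (intro sum_mono)
      fix y
      have "W y \<subseteq> Pow (monomials Y d)" using Suc.prems unfolding W_def by auto
      moreover have "(A - B) \<union> (B - A) \<in> W y" if "A \<in> W y" "B \<in> W y" for A B
        using that Suc.prems(2) finA unfolding W_def by (auto simp: chi_sym_diff)
      ultimately show "(\<Sum>\<alpha>\<in>Z \<rightarrow>\<^sub>E W y. real (c \<alpha>) ^ t) \<le> ?L ^ t * (real (card (W y)) ^ ?m * ?q ^ t + K)"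
        unfolding c_def K_def by (rule Suc.IH)
    qed
    also have "\<dots> = ?L ^ t * ((\<Sum>y\<in>Pow Y. real (card (W y)) ^ ?m) * ?q ^ t + ?L * K)"
      using Y by (simp add: sum_distrib_left[symmetric] sum.distrib sum_distrib_right[symmetric] card_Pow)
    also have "\<dots> \<le> ?L ^ t * ((?L * (real (card V) ^ ?m * ?q)) * ?q ^ t + ?L * K)"
      using sumW by (intro mult_left_mono add_right_mono mult_right_mono) auto
    also have "\<dots> = ?L ^ Suc t * (real (card V) ^ ?m * ?q ^ Suc t + K)"
      by (simp add: algebra_simps)
    finally show ?thesis unfolding c_def K_def .
  qed
qed

section \<open>Averaging over the variables of \<open>Z\<close>\<close>

definition bilinear_monomials :: "'a set \<Rightarrow> 'a set \<Rightarrow> nat \<Rightarrow> 'a set set" where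
  "bilinear_monomials Z Y d = (\<Union>j\<in>Z. insert j ` monomials Y d)"

lemma insert_monomial_eq_iff:
  assumes "Y \<inter> Z = {}" "T \<in> monomials Y d" "S \<in> monomials Y d" "i \<in> Z" "j \<in> Z"
  shows "insert i S = insert j T \<longleftrightarrow> i = j \<and> S = T"
  using assms unfolding monomials_def by (auto; blast)

lemma chi_bilinear:
  assumes "finite Y" "finite Z" "Y \<inter> Z = {}" and \<alpha>: "\<And>j. j \<in> Z \<Longrightarrow> \<alpha> j \<subseteq> monomials Y d"
  shows "chi (\<Union>j\<in>Z. insert j ` \<alpha> j) x = (\<Prod>j\<in>Z. if j \<in> x then chi (\<alpha> j) x else 1)"
proof -
  have fin: "finite (\<alpha> j)" if "j \<in> Z" for j
    using \<alpha>[OF that] assms(1) finite_subset finite_monomials by blast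
  have "chi (\<Union>j\<in>Z. insert j ` \<alpha> j) x = (\<Prod>j\<in>Z. chi (insert j ` \<alpha> j) x)"
    unfolding chi_def using assms(2) fin
  proof (intro prod.UNION_disjoint ballI impI)
    fix i j assume "i \<in> Z" "j \<in> Z" "i \<noteq> j"
    then show "insert i ` \<alpha> i \<inter> insert j ` \<alpha> j = {}"
      using insert_monomial_eq_iff[OF assms(3)] \<alpha> by blast
  qed auto
  also have "\<dots> = (\<Prod>j\<in>Z. if j \<in> x then chi (\<alpha> j) x else 1)"
  proof (intro prod.cong refl chi_image_insert)
    fix j S assume "j \<in> Z" "S \<in> \<alpha> j"
    then show "j \<notin> S" using \<alpha> assms(3) unfolding monomials_def by blast
  qed
  finally show ?thesis .
qed

text \<open>For fixed \<open>y\<close> the polynomial is linear in the variables of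
  \<open>Z\<close>. The sum over them is the product of the factors
  \<open>chi (\<alpha> j) y + 1\<close>, which is zero unless every coefficient vanishes at
  \<open>y\<close>.\<close>

lemma sum_bilinear:
  assumes Y: "finite Y" and Z: "finite Z" and disj: "Y \<inter> Z = {}" and \<alpha>: "\<And>j. j \<in> Z \<Longrightarrow> \<alpha> j \<subseteq> monomials Y d"
  shows "(\<Sum>x\<in>Pow (Y \<union> Z). chi (\<Union>j\<in>Z. insert j ` \<alpha> j) x)
    = 2 ^ card Z * real (card {y \<in> Pow Y. \<forall>j\<in>Z. chi (\<alpha> j) y = 1})"
proof -
  have "(\<Sum>x\<in>Pow (Y \<union> Z). chi (\<Union>j\<in>Z. insert j ` \<alpha> j) x)
      = (\<Sum>(y, z)\<in>Pow Y \<times> Pow Z. \<Prod>j\<in>z. chi (\<alpha> j) y)"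
  proof (rule sum.reindex_bij_witness[where i = "\<lambda>(y, z). y \<union> z" and j = "\<lambda>x. (x \<inter> Y, x \<inter> Z)"])
    fix x assume "x \<in> Pow (Y \<union> Z)"
    have "chi (\<alpha> j) x = chi (\<alpha> j) (x \<inter> Y)" if "j \<in> Z" for j
      using \<alpha>[OF that] by (intro chi_cong) (auto simp: monomials_def)
    moreover have "chi (\<Union>j\<in>Z. insert j ` \<alpha> j) x = (\<Prod>j\<in>Z. if j \<in> x then chi (\<alpha> j) x else 1)"
      using Y Z disj \<alpha> by (rule chi_bilinear)
    ultimately have "chi (\<Union>j\<in>Z. insert j ` \<alpha> j) x = (\<Prod>j\<in>Z. if j \<in> x then chi (\<alpha> j) (x \<inter> Y) else 1)"
      by (auto intro!: prod.cong)
    also have "\<dots> = (\<Prod>j\<in>{j\<in>Z. j \<in> x}. chi (\<alpha> j) (x \<inter> Y))"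
      using Z by (intro prod.inter_filter[symmetric])
    finally have "chi (\<Union>j\<in>Z. insert j ` \<alpha> j) x = (\<Prod>j\<in>x \<inter> Z. chi (\<alpha> j) (x \<inter> Y))"
      by (simp add: Int_def conj_commute)
    then show "(case (x \<inter> Y, x \<inter> Z) of (y, z) \<Rightarrow> \<Prod>j\<in>z. chi (\<alpha> j) y)
        = chi (\<Union>j\<in>Z. insert j ` \<alpha> j) x" by simp
  qed (use disj in auto)
  also have "\<dots> = (\<Sum>y\<in>Pow Y. \<Sum>z\<in>Pow Z. \<Prod>j\<in>z. chi (\<alpha> j) y)"
    by (rule sum.cartesian_product[symmetric])
  also have "\<dots> = (\<Sum>y\<in>Pow Y. \<Prod>j\<in>Z. chi (\<alpha> j) y + 1)"
    using Z by (simp add: prod_add)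
  also have "\<dots> = (\<Sum>y\<in>Pow Y. if \<forall>j\<in>Z. chi (\<alpha> j) y = 1 then 2 ^ card Z else 0)"
  proof (intro sum.cong refl)
    fix y
    show "(\<Prod>j\<in>Z. chi (\<alpha> j) y + 1) = (if \<forall>j\<in>Z. chi (\<alpha> j) y = 1 then 2 ^ card Z else 0)"
    proof (cases "\<forall>j\<in>Z. chi (\<alpha> j) y = 1")
      case False
      then obtain j where "j \<in> Z" "chi (\<alpha> j) y + 1 = 0"
        using chi_cases by (metis add.left_inverse)
      then show ?thesis using Z False by (auto intro!: prod_zero)
    qed simp
  qed
  also have "\<dots> = (\<Sum>y\<in>{y\<in>Pow Y. \<forall>j\<in>Z. chi (\<alpha> j) y = 1}. 2 ^ card Z)"
    using Y by (intro sum.inter_filter[symmetric]) simp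
  finally show ?thesis by simp
qed

text \<open>A set of bilinear monomials corresponds to exactly one family of coefficient
  polynomials, and \<open>sum_bilinear\<close> turns each character sum into a number of common
  zeros.\<close>

lemma bilinear_moment:
  assumes Y: "finite Y" and Z: "finite Z" and disj: "Y \<inter> Z = {}"
  shows "(\<Sum>A\<in>Pow (bilinear_monomials Z Y d). (\<Sum>x\<in>Pow (Y \<union> Z). chi A x) ^ t)
    = (2 ^ card Z) ^ t * (\<Sum>\<alpha>\<in>Z \<rightarrow>\<^sub>E Pow (monomials Y d).
        real (card {y \<in> Pow Y. \<forall>j\<in>Z. chi (\<alpha> j) y = 1}) ^ t)"
proof -
  have "(\<Sum>A\<in>Pow (bilinear_monomials Z Y d). (\<Sum>x\<in>Pow (Y \<union> Z). chi A x) ^ t)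
      = (\<Sum>\<alpha>\<in>Z \<rightarrow>\<^sub>E Pow (monomials Y d). (\<Sum>x\<in>Pow (Y \<union> Z). chi (\<Union>j\<in>Z. insert j ` \<alpha> j) x) ^ t)"
  proof (rule sum.reindex_bij_witness[where i = "\<lambda>\<alpha>. \<Union>j\<in>Z. insert j ` \<alpha> j"
        and j = "\<lambda>A. \<lambda>j\<in>Z. {S \<in> monomials Y d. insert j S \<in> A}"])
    fix A assume A: "A \<in> Pow (bilinear_monomials Z Y d)"
    show *: "(\<Union>j\<in>Z. insert j ` (\<lambda>j\<in>Z. {S \<in> monomials Y d. insert j S \<in> A}) j) = A"
      using A unfolding bilinear_monomials_def by fastforce
    show "(\<lambda>j\<in>Z. {S \<in> monomials Y d. insert j S \<in> A}) \<in> Z \<rightarrow>\<^sub>E Pow (monomials Y d)" by auto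
    show "(\<Sum>x\<in>Pow (Y \<union> Z). chi (\<Union>j\<in>Z. insert j ` (\<lambda>j\<in>Z. {S \<in> monomials Y d. insert j S \<in> A}) j) x) ^ t
        = (\<Sum>x\<in>Pow (Y \<union> Z). chi A x) ^ t"
      unfolding * ..
  next
    fix \<alpha> assume \<alpha>: "\<alpha> \<in> Z \<rightarrow>\<^sub>E Pow (monomials Y d)"
    have "{S \<in> monomials Y d. insert j S \<in> (\<Union>i\<in>Z. insert i ` \<alpha> i)} = \<alpha> j" if "j \<in> Z" for j
    proof (intro equalityI subsetI)
      fix S assume "S \<in> {S \<in> monomials Y d. insert j S \<in> (\<Union>i\<in>Z. insert i ` \<alpha> i)}"
      then obtain i T where "S \<in> monomials Y d" "i \<in> Z" "T \<in> \<alpha> i" "insert j S = insert i T" by auto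
      moreover from this have "T \<in> monomials Y d" using \<alpha> by auto
      ultimately show "S \<in> \<alpha> j" using insert_monomial_eq_iff[OF disj] that by metis
    qed (use \<alpha> that in auto)
    then show "(\<lambda>j\<in>Z. {S \<in> monomials Y d. insert j S \<in> (\<Union>i\<in>Z. insert i ` \<alpha> i)}) = \<alpha>"
      using \<alpha> by (intro ext) (auto simp: PiE_def extensional_def)
    show "(\<Union>j\<in>Z. insert j ` \<alpha> j) \<in> Pow (bilinear_monomials Z Y d)"
      using \<alpha> unfolding bilinear_monomials_def by fastforce
  qed
  also have "\<dots> = (\<Sum>\<alpha>\<in>Z \<rightarrow>\<^sub>E Pow (monomials Y d).
      (2 ^ card Z * real (card {y \<in> Pow Y. \<forall>j\<in>Z. chi (\<alpha> j) y = 1})) ^ t)"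
  proof (intro sum.cong refl)
    fix \<alpha> assume "\<alpha> \<in> Z \<rightarrow>\<^sub>E Pow (monomials Y d)"
    then have "\<alpha> j \<subseteq> monomials Y d" if "j \<in> Z" for j using that by auto
    then show "(\<Sum>x\<in>Pow (Y \<union> Z). chi (\<Union>j\<in>Z. insert j ` \<alpha> j) x) ^ t
        = (2 ^ card Z * real (card {y \<in> Pow Y. \<forall>j\<in>Z. chi (\<alpha> j) y = 1})) ^ t"
      by (subst sum_bilinear[OF Y Z disj]) auto
  qed
  finally show ?thesis by (simp add: power_mult_distrib sum_distrib_left)
qed

lemma card_bilinear_monomials:
  assumes Y: "finite Y" and Z: "finite Z" and disj: "Y \<inter> Z = {}"
  shows "card (bilinear_monomials Z Y d) = card Z * card (monomials Y d)"
proof -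
  have "bilinear_monomials Z Y d = (\<lambda>(j, S). insert j S) ` (Z \<times> monomials Y d)"
    unfolding bilinear_monomials_def by auto
  moreover have "inj_on (\<lambda>(j, S). insert j S) (Z \<times> monomials Y d)"
    using insert_monomial_eq_iff[OF disj] by (auto intro!: inj_onI)
  ultimately show ?thesis by (simp add: card_image card_cartesian_product)
qed

text \<open>Monomials outside \<open>?G\<close> enter only through \<open>chi C (\<phi> x)\<close>,
  a weight of absolute value 1 that \<open>moment_le\<close> removes. Monomials in \<open>?G\<close>
  lie inside \<open>Y \<union> Z\<close>, where \<open>\<phi> x\<close> agrees with
  \<open>x\<close>, so the shape of \<open>\<phi>\<close> elsewhere is irrelevant.\<close>

lemma section_moment_le:
  fixes \<phi> :: "'a set \<Rightarrow> 'a set"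
  assumes W: "finite W" and YZ: "Y \<union> Z \<subseteq> W" "Y \<inter> Z = {}" and s: "s \<le> card Y"
    and \<phi>: "\<And>x. x \<subseteq> Y \<union> Z \<Longrightarrow> \<phi> x \<inter> (Y \<union> Z) = x"
  shows "(\<Sum>A\<in>Pow (monomials W (Suc d)). (\<Sum>x\<in>Pow (Y \<union> Z). chi A (\<phi> x)) ^ t)
    \<le> 2 ^ card (monomials W (Suc d)) * (2 ^ card (Y \<union> Z)) ^ t
      * (((1/2) ^ s + (1/2) ^ card Z) ^ t + (1/2) ^ (light 0 (2 ^ (card Y - s)) d * card Z))"
proof -
  let ?F = "monomials W (Suc d)" and ?G = "bilinear_monomials Z Y d"
  let ?q = "((1/2) ^ s + (1/2) ^ card Z) ^ t + (1/2) ^ (light 0 (2 ^ (card Y - s)) d * card Z) :: real"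
  have fin: "finite Y" "finite Z" using YZ W finite_subset by blast+
  have GF: "?G \<subseteq> ?F"
  proof
    fix S assume "S \<in> ?G"
    then obtain j T where "S = insert j T" "j \<in> Z" "T \<subseteq> Y" "card T < d"
      unfolding bilinear_monomials_def monomials_def by auto
    moreover from this have "card S \<le> Suc (card T)" by (simp add: card_insert_le_m1 card_insert_if)
    ultimately show "S \<in> ?F" using YZ unfolding monomials_def by auto
  qed
  have finF: "finite ?F" using W by simp
  then have finG: "finite ?G" using GF finite_subset by blast
  have G: "(\<Sum>B\<in>Pow ?G. (\<Sum>x\<in>Pow (Y \<union> Z). g x * chi B x) ^ t) \<le> 2 ^ card ?G * (2 ^ card (Y \<union> Z)) ^ t * ?q"
    if g: "\<And>x. \<bar>g x\<bar> \<le> 1" for g :: "'a set \<Rightarrow> real"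
  proof -
    have "(\<Sum>B\<in>Pow ?G. (\<Sum>x\<in>Pow (Y \<union> Z). g x * chi B x) ^ t) \<le> (\<Sum>B\<in>Pow ?G. (\<Sum>x\<in>Pow (Y \<union> Z). chi B x) ^ t)"
      using finG g by (rule moment_le)
    \<comment> \<open>Here \<open>V\<close> is the space of all polynomials of degree less than
      \<open>d\<close> in \<open>Y\<close>. Both terms then contain \<open>2 ^ card ?G\<close>, the
      number of choices of \<open>B\<close>, as a common factor.\<close>
    also have "\<dots> \<le> (2 ^ card Z) ^ t * ((2 ^ card Y) ^ t * (real (card (Pow (monomials Y d))) ^ card Z * ((1/2) ^ s + (1/2) ^ card Z) ^ t
      + (2 ^ card (monomials Y d) / 2 ^ light 0 (2 ^ (card Y - s)) d) ^ card Z))"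
      unfolding bilinear_moment[OF fin YZ(2)] using fin s
      by (intro mult_left_mono common_zero_moment_le) auto
    also have "\<dots> = 2 ^ card ?G * (2 ^ card (Y \<union> Z)) ^ t * ?q"
      using fin YZ(2)
      by (simp add: card_Pow card_bilinear_monomials card_Un_disjoint power_mult power_add power_mult_distrib
          power_divide algebra_simps)
         (simp add: power_mult[symmetric] mult.commute power_one_over)
    finally show ?thesis .
  qed
  have "(\<Sum>A\<in>Pow ?F. (\<Sum>x\<in>Pow (Y \<union> Z). chi A (\<phi> x)) ^ t)
      = (\<Sum>(C, B)\<in>Pow (?F - ?G) \<times> Pow ?G. (\<Sum>x\<in>Pow (Y \<union> Z). chi C (\<phi> x) * chi B x) ^ t)"
  proof (rule sum.reindex_bij_witness[where i = "\<lambda>(C, B). C \<union> B" and j = "\<lambda>A. (A - ?G, A \<inter> ?G)"])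
    fix A assume A: "A \<in> Pow ?F"
    have "chi A (\<phi> x) = chi (A - ?G) (\<phi> x) * chi (A \<inter> ?G) x" if "x \<in> Pow (Y \<union> Z)" for x
    proof -
      have "finite A" using A finF finite_subset by blast
      then have "chi A (\<phi> x) = chi (A - ?G) (\<phi> x) * chi (A \<inter> ?G) (\<phi> x)"
        by (subst chi_union[symmetric]) (auto intro: arg_cong[where f = "\<lambda>A. chi A (\<phi> x)"])
      moreover have "chi (A \<inter> ?G) (\<phi> x) = chi (A \<inter> ?G) x"
      proof (rule chi_cong)
        fix S assume "S \<in> A \<inter> ?G"
        then have "S \<subseteq> Y \<union> Z" unfolding bilinear_monomials_def monomials_def by auto
        then show "S \<subseteq> \<phi> x \<longleftrightarrow> S \<subseteq> x" using \<phi>[of x] that by blast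
      qed
      ultimately show ?thesis by simp
    qed
    then show "(case (A - ?G, A \<inter> ?G) of (C, B) \<Rightarrow> (\<Sum>x\<in>Pow (Y \<union> Z). chi C (\<phi> x) * chi B x) ^ t)
        = (\<Sum>x\<in>Pow (Y \<union> Z). chi A (\<phi> x)) ^ t" by simp
  qed (use GF in auto)
  also have "\<dots> = (\<Sum>C\<in>Pow (?F - ?G). \<Sum>B\<in>Pow ?G. (\<Sum>x\<in>Pow (Y \<union> Z). chi C (\<phi> x) * chi B x) ^ t)"
    by (rule sum.cartesian_product[symmetric])
  also have "\<dots> \<le> (\<Sum>C\<in>Pow (?F - ?G). 2 ^ card ?G * (2 ^ card (Y \<union> Z)) ^ t * ?q)"
    by (intro sum_mono G) simp
  also have "\<dots> = 2 ^ card (?F - ?G) * 2 ^ card ?G * (2 ^ card (Y \<union> Z)) ^ t * ?q"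
    using finF by (simp add: card_Pow)
  also have "2 ^ card (?F - ?G) * 2 ^ card ?G = (2 ^ card ?F :: real)"
    using GF finF finG card_mono[OF finF GF] by (simp add: card_Diff_subset power_add[symmetric])
  finally show ?thesis .
qed

section \<open>The union bound\<close>

text \<open>
  The affine map with value \<open>u\<close> at the origin and linear part \<open>W\<close>, the support of its matrix.
\<close>

definition xor_section :: "nat \<Rightarrow> nat set \<Rightarrow> (nat \<times> nat) set \<Rightarrow> nat set \<Rightarrow> nat set" where
  "xor_section n u W x = {l. l < n \<and> odd (card {i\<in>x. (i, l) \<in> W} + of_bool (l \<in> u))}"

definition section_over :: "'a set \<Rightarrow> ('a set \<Rightarrow> 'a set) \<Rightarrow> bool" where
  "section_over I \<phi> \<longleftrightarrow> (\<forall>x. x \<subseteq> I \<longrightarrow> \<phi> x \<inter> I = x)"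

text \<open>With \<open>e = d - 1\<close>, \<open>(M choose e) \<ge> (M / e) ^ e\<close>. The factor
  \<open>d\<close> in the hypothesis absorbs the division by \<open>e\<close>, and the
  \<open>e\<close>-th power of the root gives back \<open>n\<close>. The value \<open>80 * n\<close>
  is the order of the moment used below.\<close>

lemma light_ge:
  assumes "2 \<le> d" "0 < n" "80 * real d * real n powr (1 / (real d - 1)) \<le> real M"
  shows "80 * n \<le> light 0 (2 ^ M) d"
proof -
  obtain e where d: "d = Suc e" and e: "0 < e" using assms(1) by (cases d) auto
  let ?r = "real n powr (1 / real e)"
  have re: "?r ^ e = real n" using e assms(2) by (simp add: powr_power)
  have "1 \<le> ?r" using assms(2) by (simp add: ge_one_powr_ge_zero)
  then have "real e * 1 \<le> 80 * real d * ?r"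
    using d by (intro mult_mono) auto
  then have eM: "e \<le> M" using assms(3) d by simp
  have "real e * (80 * ?r) \<le> real d * (80 * ?r)" using d by (intro mult_right_mono) auto
  also have "\<dots> \<le> real M" using assms(3) d by (simp add: algebra_simps)
  finally have "80 * ?r \<le> real M / real e" using e by (simp add: pos_le_divide_eq mult_ac)
  then have "(80 * ?r) ^ e \<le> (real M / real e) ^ e" by (intro power_mono) auto
  also have "\<dots> \<le> real (M choose e)" using binomial_ge_n_over_k_pow_k[OF eM, where 'a = real] by simp
  also have "\<dots> \<le> real (light 0 (2 ^ M) d)" using binomial_le_light[of M e] d by simp
  finally have "80 ^ e * real n \<le> real (light 0 (2 ^ M) d)" by (simp add: power_mult_distrib re)
  moreover have "(80::real) ^ 1 \<le> 80 ^ e" using e by (intro power_increasing) auto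
  then have "80 * real n \<le> 80 ^ e * real n" by (intro mult_right_mono) auto
  ultimately have "real (80 * n) \<le> real (light 0 (2 ^ M) d)" by simp
  then show ?thesis by (simp only: of_nat_le_iff)
qed

text \<open>Markov's inequality for the moment of order \<open>80 * n\<close>, with the bound of
  \<open>section_moment_le\<close>.\<close>

lemma card_large_sum_le:
  fixes \<phi> :: "'a set \<Rightarrow> 'a set"
  assumes d: "2 \<le> d" and n: "0 < n" and W: "finite W" "I \<subseteq> W"
    and k: "160 * real d * real n powr (1 / (real d - 1)) \<le> real (card I)"
    and \<phi>: "section_over I \<phi>"
  shows "real (card {A \<in> Pow (monomials W (Suc d)).
      2 ^ card I * 2 powr (- (real (card I) / 16)) < \<bar>\<Sum>x\<in>Pow I. chi A (\<phi> x)\<bar>})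
    \<le> 2 ^ card (monomials W (Suc d)) * (2 * (1/2) ^ (5 * n * card I))"
proof -
  define k m t where "k = card I" and "m = k div 4" and "t = 80 * n"
  have finI: "finite I" using W finite_subset by blast
  have "1 \<le> real n powr (1 / (real d - 1))" using n d by (simp add: ge_one_powr_ge_zero)
  then have "160 * 2 * 1 \<le> 160 * real d * real n powr (1 / (real d - 1))"
    using d by (intro mult_mono) auto
  then have k14: "14 \<le> k" using k k_def by linarith
  have "m \<le> k" unfolding m_def by simp
  then obtain Z where Z: "Z \<subseteq> I" "card Z = m"
    unfolding k_def by (meson obtain_subset_with_card_n)
  define Y where "Y = I - Z"
  have YZ: "Y \<union> Z = I" "Y \<inter> Z = {}" using Z unfolding Y_def by auto
  have cardY: "card Y = k - m"
    unfolding Y_def k_def using Z finI by (metis card_Diff_subset finite_subset)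
  have mY: "m \<le> card Y" using cardY unfolding m_def by simp
  \<comment> \<open>The rank bound sees only \<open>card Y - m = k - 2 * m\<close> dimensions, at
    least half of \<open>k\<close>; this is why 160 is twice the constant of
    \<open>light_ge\<close>.\<close>
  have "real k \<le> 2 * real (card Y - m)" using cardY unfolding m_def by linarith
  then have "80 * real d * real n powr (1 / (real d - 1)) \<le> real (card Y - m)"
    using k unfolding k_def by linarith
  then have tH: "t \<le> light 0 (2 ^ (card Y - m)) d"
    unfolding t_def using light_ge d n by blast
  have m1: "k \<le> 8 * (m - 1)" "1 \<le> m" using k14 unfolding m_def by linarith+
  have ge: "10 * n * k \<le> (m - 1) * t"
    using mult_le_mono2[OF m1(1), of "10 * n"] unfolding t_def by (simp add: mult_ac)
  have "(1/2) ^ m + (1/2) ^ m = ((1/2) ^ (m - 1) :: real)"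
    using m1 by (cases m) auto
  then have q1: "((1/2) ^ m + (1/2) ^ m) ^ t \<le> ((1/2) ^ (10 * n * k) :: real)"
    using ge by (simp add: power_mult[symmetric])
  have "(m - 1) * t \<le> light 0 (2 ^ (card Y - m)) d * m"
    using mult_mono[OF _ tH, of "m - 1" m] by (simp add: mult.commute)
  then have q2: "(1/2) ^ (light 0 (2 ^ (card Y - m)) d * m) \<le> ((1/2) ^ (10 * n * k) :: real)"
    using ge by (intro power_decreasing) auto
  let ?F = "monomials W (Suc d)" and ?\<delta> = "2 powr (- (real k / 16)) :: real"
  let ?s = "\<lambda>A. \<Sum>x\<in>Pow I. chi A (\<phi> x)"
  let ?B = "{A \<in> Pow ?F. 2 ^ k * ?\<delta> < \<bar>?s A\<bar>}"
  \<comment> \<open>Evenness lets the moment control absolute values and makes the terms outside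
    \<open>?B\<close> nonnegative.\<close>
  have even: "even t" unfolding t_def by simp
  have "real (card ?B) * (2 ^ k * ?\<delta>) ^ t = (\<Sum>A\<in>?B. (2 ^ k * ?\<delta>) ^ t)" by simp
  also have "\<dots> \<le> (\<Sum>A\<in>?B. ?s A ^ t)"
  proof (rule sum_mono)
    fix A assume "A \<in> ?B"
    then have "(2 ^ k * ?\<delta>) ^ t \<le> \<bar>?s A\<bar> ^ t" by (intro power_mono) auto
    then show "(2 ^ k * ?\<delta>) ^ t \<le> ?s A ^ t" using even by (simp add: power_even_abs)
  qed
  also have "\<dots> \<le> (\<Sum>A\<in>Pow ?F. ?s A ^ t)"
    using W even by (intro sum_mono2) (auto simp: zero_le_even_power)
  also have "\<dots> \<le> 2 ^ card ?F * (2 ^ k) ^ t * (((1/2) ^ m + (1/2) ^ m) ^ t + (1/2) ^ (light 0 (2 ^ (card Y - m)) d * m))"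
    using section_moment_le[OF W(1), of Y Z m \<phi> t d] YZ W(2) mY \<phi> Z(2) unfolding k_def section_over_def by simp
  also have "\<dots> \<le> 2 ^ card ?F * (2 ^ k) ^ t * ((1/2) ^ (10 * n * k) + (1/2) ^ (10 * n * k))"
    using q1 q2 by (intro mult_left_mono add_mono) auto
  finally have "real (card ?B) * ?\<delta> ^ t * (2 ^ k) ^ t \<le> 2 ^ card ?F * (2 * (1/2) ^ (10 * n * k)) * (2 ^ k) ^ t"
    by (simp add: power_mult_distrib mult_ac)
  then have "real (card ?B) * ?\<delta> ^ t \<le> 2 ^ card ?F * (2 * (1/2) ^ (10 * n * k))"
    by (rule mult_right_le_imp_le) simp
  also have "(1/2) ^ (10 * n * k) = ((1/2) ^ (5 * n * k) * (1/2) ^ (5 * n * k) :: real)"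
    by (simp add: power_add[symmetric] mult_ac)
  also have "?\<delta> ^ t = (1/2) ^ (5 * n * k)"
  proof -
    have "?\<delta> ^ t = 2 powr (- (real (5 * n * k)))"
      unfolding t_def by (subst powr_power) (simp_all add: mult_ac)
    also have "\<dots> = (1/2) ^ (5 * n * k)"
      by (subst powr_minus, subst powr_realpow) (simp_all add: power_one_over inverse_eq_divide)
    finally show ?thesis .
  qed
  finally have "real (card ?B) * (1/2) ^ (5 * n * k) \<le> (2 ^ card ?F * (2 * (1/2) ^ (5 * n * k))) * (1/2) ^ (5 * n * k)"
    by (simp add: mult_ac)
  then have "real (card ?B) \<le> 2 ^ card ?F * (2 * (1/2) ^ (5 * n * k))"
    by (rule mult_right_le_imp_le) simp
  then show ?thesis unfolding k_def .
qed

lemma card_Pow_containing: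
  assumes "finite F" "S \<in> F"
  shows "2 * card {A \<in> Pow F. S \<in> A} = 2 ^ card F"
proof -
  have "{A \<in> Pow F. S \<in> A} = insert S ` Pow (F - {S})"
  proof (intro equalityI subsetI)
    fix A assume "A \<in> {A \<in> Pow F. S \<in> A}"
    then have "A = insert S (A - {S})" "A - {S} \<in> Pow (F - {S})" by auto
    then show "A \<in> insert S ` Pow (F - {S})" by blast
  qed (use assms in auto)
  moreover have "inj_on (insert S) (Pow (F - {S}))"
    by (auto intro!: inj_onI)
  ultimately have "card {A \<in> Pow F. S \<in> A} = 2 ^ card (F - {S})"
    using assms by (simp add: card_image card_Pow)
  then show ?thesis using card.remove[OF assms] by simp
qed

text \<open>A union bound over the coordinate sets and the affine maps on them. The bad polynomials
  are fewer than half of all, while exactly half contain the monomial \<open>{..<d}\<close>; hence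
  some good polynomial has degree exactly \<open>d\<close>.\<close>

lemma exists_small_section_sums:
  assumes d: "2 \<le> d" and dn: "2 * d < n"
  shows "\<exists>A. A \<subseteq> monomials {..<n} (Suc d) \<and> {..<d} \<in> A \<and>
    (\<forall>I u W. I \<subseteq> {..<n} \<and> 160 * real d * real n powr (1 / (real d - 1)) \<le> real (card I) \<and>
      u \<subseteq> {..<n} \<and> W \<subseteq> I \<times> {..<n} \<and> section_over I (xor_section n u W) \<longrightarrow>
      \<bar>\<Sum>x\<in>Pow I. chi A (xor_section n u W x)\<bar> \<le> 2 ^ card I * 2 powr (- (real (card I) / 16)))"
proof -
  let ?F = "monomials {..<n} (Suc d)"
  define Is where "Is = {I \<in> Pow {..<n}. 160 * real d * real n powr (1 / (real d - 1)) \<le> real (card I)}"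
  define T where "T I = {p \<in> Pow {..<n} \<times> Pow (I \<times> {..<n}). section_over I (xor_section n (fst p) (snd p))}" for I
  define Bad where "Bad I p = {A \<in> Pow ?F. 2 ^ card I * 2 powr (- (real (card I) / 16))
      < \<bar>\<Sum>x\<in>Pow I. chi A (xor_section n (fst p) (snd p) x)\<bar>}" for I p
  have n: "0 < n" using dn by simp
  have cancel: "2 ^ p * (c * (2 * (1/2) ^ (q + p))) = c * (2 * (1/2) ^ q)" for p q :: nat and c :: real
    by (simp add: power_add power_one_over)
  have Bad: "real (card (Bad I p)) \<le> 2 ^ card ?F * (2 * (1/2) ^ (5 * n * card I))"
    if "I \<in> Is" "p \<in> T I" for I p
  proof -
    have "section_over I (xor_section n (fst p) (snd p))"
      using \<open>p \<in> T I\<close> unfolding T_def by blast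
    moreover have "I \<subseteq> {..<n}" "160 * real d * real n powr (1 / (real d - 1)) \<le> real (card I)"
      using \<open>I \<in> Is\<close> unfolding Is_def by auto
    ultimately show ?thesis
      unfolding Bad_def using card_large_sum_le[OF d n finite_lessThan, of I n "xor_section n (fst p) (snd p)"] by blast
  qed
  have finI: "finite I" if "I \<in> Is" for I
    using that finite_subset[OF _ finite_lessThan] unfolding Is_def by blast
  have finT: "finite (T I)" if "I \<in> Is" for I
  proof (rule finite_subset)
    show "T I \<subseteq> Pow {..<n} \<times> Pow (I \<times> {..<n})" unfolding T_def by blast
    show "finite (Pow {..<n} \<times> Pow (I \<times> {..<n}))" using finI[OF that] by simp
  qed
  have cardT: "card (T I) \<le> 2 ^ (n + card I * n)" if "I \<in> Is" for I
  proof -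
    have fin: "finite I" using that by (rule finI)
    have "card (T I) \<le> card (Pow {..<n} \<times> Pow (I \<times> {..<n}))"
      unfolding T_def using fin by (intro card_mono) (simp, blast)
    also have "\<dots> = 2 ^ (n + card I * n)"
      using fin by (simp add: card_cartesian_product card_Pow power_add)
    finally show ?thesis .
  qed
  have Bads: "real (card (\<Union>p\<in>T I. Bad I p)) \<le> 2 ^ card ?F * (2 * (1/2) ^ (3 * n))" if I: "I \<in> Is" for I
  proof -
    have "0 < 160 * real d * real n powr (1 / (real d - 1))" using n d by simp
    then have k: "1 \<le> card I" using I unfolding Is_def by force
    have "n \<le> card I * n" using k by simp
    \<comment> \<open>Of the exponent \<open>5 * n * card I\<close>, the number of pairs
      \<open>(u, W)\<close> consumes \<open>n + card I * n\<close>. At least \<open>3 * n\<close> is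
      left, and the choice of \<open>I\<close> later takes another \<open>n\<close>.\<close>
    then have exp: "3 * n + (n + card I * n) \<le> 5 * n * card I" by (simp add: algebra_simps)
    have "real (card (\<Union>p\<in>T I. Bad I p)) \<le> real (\<Sum>p\<in>T I. card (Bad I p))"
      using card_UN_le[OF finT[OF I], of "Bad I"] by (simp only: of_nat_le_iff)
    also have "\<dots> \<le> (\<Sum>p\<in>T I. 2 ^ card ?F * (2 * (1/2) ^ (5 * n * card I)))"
      unfolding of_nat_sum by (intro sum_mono Bad I)
    also have "\<dots> = real (card (T I)) * (2 ^ card ?F * (2 * (1/2) ^ (5 * n * card I)))" by simp
    also have "\<dots> \<le> 2 ^ (n + card I * n) * (2 ^ card ?F * (2 * (1/2) ^ (5 * n * card I)))"
    proof (rule mult_right_mono)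
      have "real (card (T I)) \<le> real (2 ^ (n + card I * n))"
        using cardT[OF I] by (simp only: of_nat_le_iff)
      then show "real (card (T I)) \<le> 2 ^ (n + card I * n)" by simp
    qed simp
    also have "\<dots> \<le> 2 ^ (n + card I * n) * (2 ^ card ?F * (2 * (1/2) ^ (3 * n + (n + card I * n))))"
      using exp by (intro mult_left_mono power_decreasing) auto
    also have "\<dots> = 2 ^ card ?F * (2 * (1/2) ^ (3 * n))"
      by (rule cancel)
    finally show ?thesis .
  qed
  have finIs: "finite Is" unfolding Is_def by simp
  have "real (card (\<Union>I\<in>Is. \<Union>p\<in>T I. Bad I p)) \<le> real (\<Sum>I\<in>Is. card (\<Union>p\<in>T I. Bad I p))"
    using card_UN_le[OF finIs, of "\<lambda>I. \<Union>p\<in>T I. Bad I p"] by (simp only: of_nat_le_iff)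
  also have "\<dots> \<le> (\<Sum>I\<in>Is. 2 ^ card ?F * (2 * (1/2) ^ (3 * n)))"
    unfolding of_nat_sum by (intro sum_mono Bads)
  also have "\<dots> \<le> (\<Sum>I\<in>Pow {..<n}. 2 ^ card ?F * (2 * (1/2) ^ (3 * n)))"
    unfolding Is_def by (intro sum_mono2) auto
  also have "\<dots> = 2 ^ card ?F * (2 * (1/2) ^ (2 * n))"
    using cancel[of n "2 ^ card ?F" "2 * n"] by (simp add: card_Pow)
  \<comment> \<open>Already the exponent 3 leaves a fraction 1/4, below the fraction 1/2 of
    polynomials containing \<open>{..<d}\<close>.\<close>
  also have "\<dots> \<le> 2 ^ card ?F * (2 * (1/2) ^ 3)"
    using d dn by (intro mult_left_mono power_decreasing) auto
  also have "\<dots> < 2 ^ card ?F / 2" by (simp add: power_one_over)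
  also have "\<dots> = real (card {A \<in> Pow ?F. {..<d} \<in> A})"
  proof -
    have "{..<d} \<in> ?F" using dn unfolding monomials_def by auto
    then have "2 * card {A \<in> Pow ?F. {..<d} \<in> A} = 2 ^ card ?F"
      by (intro card_Pow_containing) auto
    then have "real (2 * card {A \<in> Pow ?F. {..<d} \<in> A}) = real (2 ^ card ?F)"
      by (rule arg_cong)
    then show ?thesis by simp
  qed
  finally have less: "card (\<Union>I\<in>Is. \<Union>p\<in>T I. Bad I p) < card {A \<in> Pow ?F. {..<d} \<in> A}" by simp
  have "finite (\<Union>I\<in>Is. \<Union>p\<in>T I. Bad I p)"
    by (rule finite_subset[of _ "Pow ?F"]) (auto simp: Bad_def)
  then have "\<not> {A \<in> Pow ?F. {..<d} \<in> A} \<subseteq> (\<Union>I\<in>Is. \<Union>p\<in>T I. Bad I p)"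
    using less card_mono not_le by blast
  then obtain A where "A \<in> {A \<in> Pow ?F. {..<d} \<in> A}" and notin: "A \<notin> (\<Union>I\<in>Is. \<Union>p\<in>T I. Bad I p)"
    by (meson subsetI)
  then have A: "A \<subseteq> ?F" "{..<d} \<in> A" by auto
  have "\<bar>\<Sum>x\<in>Pow I. chi A (xor_section n u W x)\<bar> \<le> 2 ^ card I * 2 powr (- (real (card I) / 16))"
    if "I \<subseteq> {..<n}" "160 * real d * real n powr (1 / (real d - 1)) \<le> real (card I)"
      "u \<subseteq> {..<n}" "W \<subseteq> I \<times> {..<n}" "section_over I (xor_section n u W)" for I u W
  proof -
    have "I \<in> Is" using that unfolding Is_def by blast
    moreover have "(u, W) \<in> T I" using that unfolding T_def by simp
    ultimately have "A \<notin> Bad I (u, W)" using notin by blast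
    then show ?thesis using A(1) unfolding Bad_def fst_conv snd_conv mem_Collect_eq Pow_iff
      by simp
  qed
  with A show ?thesis by (intro exI[of _ A] conjI allI impI) simp_all
qed

section \<open>Affine subspaces as sections over an information set\<close>

text \<open>A finite space is generated by its own elements, so it has a finite basis, and
  coordinates give the count. Below, the dimension is accessed only through this
  cardinality.\<close>

lemma (in vectorspace) card_carrier_eq_card_power_dim:
  assumes "finite (carrier V)"
  shows "card (carrier V) = card (carrier K) ^ dim"
proof -
  have "gen_set (carrier V)"
    by (metis in_own_span span_is_subset2 subset_antisym subset_refl)
  then have "fin_dim"
    unfolding fin_dim_def using assms by blast
  then obtain B where B: "finite B" "basis B"
    using finite_basis_exists by blast
  have BV: "B \<subseteq> carrier V" using B basis_def by blast
  have uniq: "\<exists>!a. a \<in> B \<rightarrow>\<^sub>E carrier K \<and> lincomb a B = v" if "v \<in> carrier V" for v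
    using basis_criterion[OF B(1) BV] B(2) that by blast
  have lc: "lincomb a B \<in> carrier V" if "a \<in> B \<rightarrow>\<^sub>E carrier K" for a
    using that BV by (intro lincomb_closed) auto
  have "bij_betw (\<lambda>a. lincomb a B) (B \<rightarrow>\<^sub>E carrier K) (carrier V)"
    unfolding bij_betw_def inj_on_def using uniq lc by (auto simp: image_iff) metis+
  then have "card (carrier V) = card (B \<rightarrow>\<^sub>E carrier K)"
    using bij_betw_same_card by fastforce
  then show ?thesis
    using B by (simp add: card_PiE dim_basis)
qed

section \<open>Vectors over the two-element field as sets of coordinates\<close>

definition vec_support :: "nat \<Rightarrow> bit vec \<Rightarrow> nat set" where
  "vec_support n x = {l. l < n \<and> x $ l = 1}"

lemma vec_support_add:
  assumes xy: "x \<in> carrier_vec n" "y \<in> carrier_vec n"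
  shows "vec_support n (x + y) = (vec_support n x - vec_support n y) \<union> (vec_support n y - vec_support n x)"
proof (rule Set.set_eqI)
  fix l
  show "l \<in> vec_support n (x + y) \<longleftrightarrow> l \<in> (vec_support n x - vec_support n y) \<union> (vec_support n y - vec_support n x)"
  proof (cases "l < n")
    case True
    then have "(x + y) $ l = x $ l + y $ l" using xy by simp
    then show ?thesis using True unfolding vec_support_def
      by (cases "x $ l"; cases "y $ l") simp_all
  qed (simp add: vec_support_def)
qed

lemma inj_on_vec_support: "inj_on (vec_support n) (carrier_vec n)"
proof (rule inj_onI, rule eq_vecI)
  fix x y :: "bit vec" and l
  assume "x \<in> carrier_vec n" "y \<in> carrier_vec n" "vec_support n x = vec_support n y" "l < dim_vec y"
  then have "l < n" "l \<in> vec_support n x \<longleftrightarrow> l \<in> vec_support n y" by auto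
  then show "x $ l = y $ l" unfolding vec_support_def
    by (cases "x $ l"; cases "y $ l") simp_all
qed auto

lemma finite_carrier_vec_bit: "finite (carrier_vec n :: bit vec set)"
proof (rule inj_on_finite[OF inj_on_vec_support])
  show "vec_support n ` carrier_vec n \<subseteq> Pow {..<n}" unfolding vec_support_def by auto
qed simp

lemma F2_subspaceD:
  assumes "F2_subspace n U"
  shows "U \<subseteq> carrier_vec n" "0\<^sub>v n \<in> U" "\<And>u v. u \<in> U \<Longrightarrow> v \<in> U \<Longrightarrow> u + v \<in> U"
    "card U = 2 ^ F2_dim n U"
proof -
  interpret V: vec_space "TYPE(bit)" n .
  have sub: "VectorSpace.subspace class_ring U V.V" using assms unfolding F2_subspace_def .
  interpret W: vectorspace class_ring "V.V\<lparr>carrier := U\<rparr>"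
    using sub by (rule V.subspace_is_vs)
  have m: "submodule class_ring U V.V" using sub unfolding VectorSpace.subspace_def by blast
  show U: "U \<subseteq> carrier_vec n" using m unfolding submodule_def by (simp add: module_vec_simps)
  show "0\<^sub>v n \<in> U" using m unfolding submodule_def by (auto simp: module_vec_simps)
  show "\<And>u v. u \<in> U \<Longrightarrow> v \<in> U \<Longrightarrow> u + v \<in> U" using m unfolding submodule_def by (auto simp: module_vec_simps)
  have "(UNIV :: bit set) = {0, 1}" by (auto intro: bit.exhaust)
  then have "card (UNIV :: bit set) = card {0, 1 :: bit}" by (rule arg_cong)
  then have "card (UNIV :: bit set) = 2" by simp
  moreover have "finite U" using U finite_carrier_vec_bit finite_subset by blast
  ultimately show "card U = 2 ^ F2_dim n U"
    using W.card_carrier_eq_card_power_dim unfolding F2_dim_def by (simp add: class_ring_simps)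
qed

section \<open>Signs of polynomial values as characters\<close>

lemma bit_sign_0 [simp]: "bit_sign 0 = 1"
  by (simp add: bit_sign_def)

lemma bit_sign_add: "bit_sign (a + b) = bit_sign a * bit_sign b"
  by (cases a; cases b) (simp_all add: bit_sign_def)

lemma bit_sign_sum: "bit_sign (sum f A) = (\<Prod>x\<in>A. bit_sign (f x))"
proof (induction A rule: infinite_finite_induct)
  case (insert x A)
  then show ?case by (simp only: sum.insert prod.insert bit_sign_add simp_thms)
qed simp_all

lemma prod_support:
  assumes "finite S" "S \<subseteq> {..<n}"
  shows "(\<Prod>i\<in>S. x $ i) = of_bool (S \<subseteq> vec_support n x)"
  using assms by (induction S rule: finite_induct) (auto simp: vec_support_def)

lemma bit_sign_F2_poly_eval:
  assumes "A \<subseteq> Pow {..<n}"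
  shows "bit_sign (F2_poly_eval n (\<lambda>S. of_bool (S \<in> A)) x) = chi A (vec_support n x)"
proof -
  have "bit_sign (F2_poly_eval n (\<lambda>S. of_bool (S \<in> A)) x)
      = (\<Prod>S\<in>Pow {..<n}. if S \<in> A then (if S \<subseteq> vec_support n x then -1 else 1) else 1)"
    unfolding F2_poly_eval_def bit_sign_sum
    by (intro prod.cong refl) (auto simp: prod_support finite_subset bit_sign_def)
  also have "\<dots> = chi A (vec_support n x)"
    unfolding chi_def using assms by (subst prod.inter_restrict[symmetric]) (simp_all add: Int_absorb1)
  finally show ?thesis .
qed

lemma F2_poly_degree_indicator:
  assumes "A \<subseteq> monomials {..<n} (Suc d)" "S \<in> A" "card S = d"
  shows "F2_poly_degree n (\<lambda>S. of_bool (S \<in> A)) = d"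
proof -
  have "{S \<in> Pow {..<n}. (of_bool (S \<in> A) :: bit) \<noteq> 0} = A"
    using assms(1) unfolding monomials_def by auto
  moreover have "finite A" using assms(1) finite_subset by (metis finite_lessThan finite_monomials)
  moreover have "card T \<le> d" if "T \<in> A" for T using that assms(1) unfolding monomials_def by auto
  ultimately show ?thesis
    unfolding F2_poly_degree_def using assms(2,3) by (intro Max_eqI) auto
qed

text \<open>
  Take a minimal set of coordinates with injective projection: minimality puts the unit vectors into
  the image.
\<close>

lemma information_set_exists:
  assumes U: "U \<subseteq> carrier_vec n" "\<And>u v. u \<in> U \<Longrightarrow> v \<in> U \<Longrightarrow> u + v \<in> U"
  shows "\<exists>I w. I \<subseteq> {..<n} \<and> inj_on (\<lambda>u. vec_support n u \<inter> I) U \<and>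
    (\<forall>i\<in>I. w i \<in> U \<and> vec_support n (w i) \<inter> I = {i})"
proof -
  define P where "P I \<longleftrightarrow> I \<subseteq> {..<n} \<and> inj_on (\<lambda>u. vec_support n u \<inter> I) U" for I
  have "vec_support n u \<inter> {..<n} = vec_support n u" for u unfolding vec_support_def by auto
  then have "P {..<n}"
    unfolding P_def using inj_on_subset[OF inj_on_vec_support U(1)] by simp
  then obtain I where I: "P I" "\<And>J. P J \<Longrightarrow> card I \<le> card J"
    using ex_has_least_nat[of P "{..<n}" card] by blast
  have finI: "finite I" using I(1) finite_subset unfolding P_def by blast
  have "\<exists>w. w \<in> U \<and> vec_support n w \<inter> I = {i}" if i: "i \<in> I" for i
  proof -
    \<comment> \<open>Without \<open>i\<close>, two members of \<open>U\<close> collide. On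
      \<open>I\<close> they differ exactly in \<open>i\<close>, so their sum is a unit vector
      there.\<close>
    have "\<not> P (I - {i})" using I(2)[of "I - {i}"] card_Diff1_less[OF finI i] by linarith
    then obtain u v where uv: "u \<in> U" "v \<in> U" "u \<noteq> v"
        "vec_support n u \<inter> (I - {i}) = vec_support n v \<inter> (I - {i})"
      using I(1) unfolding P_def inj_on_def by blast
    have ne: "vec_support n u \<inter> I \<noteq> vec_support n v \<inter> I"
      using I(1) uv unfolding P_def inj_on_def by blast
    have "vec_support n (u + v)
        = (vec_support n u - vec_support n v) \<union> (vec_support n v - vec_support n u)"
      using uv U(1) by (intro vec_support_add) auto
    then have "vec_support n (u + v) \<inter> I = {i}" using uv(4) ne by blast
    then show ?thesis using U(2) uv by blast
  qed
  then have "\<exists>w. \<forall>i\<in>I. w i \<in> U \<and> vec_support n (w i) \<inter> I = {i}" by (intro bchoice ballI)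
  with I(1) show ?thesis unfolding P_def by (elim exE conjE) (intro exI conjI)
qed

lemma xor_section_insert:
  assumes "finite x" "i \<notin> x" and w: "\<And>l. l < n \<Longrightarrow> (i, l) \<in> W \<longleftrightarrow> l \<in> s" and s: "s \<subseteq> {..<n}"
  shows "xor_section n u W (insert i x) = (xor_section n u W x - s) \<union> (s - xor_section n u W x)"
proof -
  have "{j \<in> insert i x. (j, l) \<in> W} = (if (i, l) \<in> W then insert i {j \<in> x. (j, l) \<in> W} else {j \<in> x. (j, l) \<in> W})" for l
    by auto
  then have "card {j \<in> insert i x. (j, l) \<in> W} = card {j \<in> x. (j, l) \<in> W} + of_bool ((i, l) \<in> W)" for l
    using assms(1,2) by simp
  then show ?thesis
    using w s unfolding xor_section_def by auto
qed

text \<open>Projection to an information set \<open>I\<close> is a bijection from \<open>U\<close>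
  onto \<open>Pow I\<close>: injective by the choice of \<open>I\<close>, onto because sums of the
  \<open>w i\<close> realize every trace. Counting then gives \<open>card I\<close> as the
  dimension. The rows of \<open>W\<close> are the supports of the \<open>w i\<close>.\<close>

lemma affine_subspace_as_xor_section:
  assumes u0: "u0 \<in> carrier_vec n" and U: "F2_subspace n U"
  obtains I u W where "I \<subseteq> {..<n}" "card I = F2_dim n U" "u \<subseteq> {..<n}" "W \<subseteq> I \<times> {..<n}"
    "section_over I (xor_section n u W)"
    "\<And>h :: nat set \<Rightarrow> real. (\<Sum>z\<in>affine_translate u0 U. h (vec_support n z)) = (\<Sum>x\<in>Pow I. h (xor_section n u W x))"
    "card (affine_translate u0 U) = 2 ^ F2_dim n U"
proof -
  note U = F2_subspaceD[OF U]
  let ?supp = "vec_support n"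
  have "\<exists>I w. I \<subseteq> {..<n} \<and> inj_on (\<lambda>u. ?supp u \<inter> I) U \<and> (\<forall>i\<in>I. w i \<in> U \<and> ?supp (w i) \<inter> I = {i})"
    using U(1,3) by (rule information_set_exists)
  then obtain I w where I: "I \<subseteq> {..<n}" "inj_on (\<lambda>u. ?supp u \<inter> I) U"
    and iw: "\<forall>i\<in>I. w i \<in> U \<and> ?supp (w i) \<inter> I = {i}"
    by (elim exE conjE)
  have w: "w i \<in> U" "?supp (w i) \<inter> I = {i}" if "i \<in> I" for i using iw that by auto
  have finI: "finite I" using I finite_subset by blast
  have sub: "?supp z \<subseteq> {..<n}" for z unfolding vec_support_def by auto
  have zero: "?supp (0\<^sub>v n) = {}" unfolding vec_support_def by auto
  have surj: "\<exists>z\<in>U. ?supp z \<inter> I = x" if "x \<subseteq> I" for x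
  proof -
    have "finite x" using that finI finite_subset by blast
    then show ?thesis using that
    proof (induction x rule: finite_induct)
      case empty
      then show ?case using U(2) zero by (intro bexI[of _ "0\<^sub>v n"]) auto
    next
      case (insert i x)
      then obtain z where z: "z \<in> U" "?supp z \<inter> I = x" by auto
      have i: "i \<in> I" using insert.prems by simp
      have "?supp (z + w i) = (?supp z - ?supp (w i)) \<union> (?supp (w i) - ?supp z)"
        using z(1) w(1)[OF i] U(1) by (intro vec_support_add) blast+
      then have "?supp (z + w i) \<inter> I = insert i x"
        using z(2) w(2)[OF i] insert.hyps by auto
      then show ?case using U(3)[OF z(1) w(1)[OF i]] by (rule bexI)
    qed
  qed
  have "bij_betw (\<lambda>u. ?supp u \<inter> I) U (Pow I)"
    unfolding bij_betw_def using I(2) surj by (auto simp: image_iff)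
  then have "card U = 2 ^ card I" using bij_betw_same_card finI card_Pow by metis
  then have cardI: "card I = F2_dim n U" using U(4) by simp
  define T where "T = affine_translate u0 U"
  have TI: "z \<in> T \<longleftrightarrow> (\<exists>u\<in>U. z = u0 + u)" for z unfolding T_def affine_translate_def by auto
  have supp_T: "?supp (u0 + v) = (?supp u0 - ?supp v) \<union> (?supp v - ?supp u0)" if "v \<in> U" for v
    using that u0 U(1) by (intro vec_support_add) auto
  have T_add: "z + v \<in> T" "?supp (z + v) = (?supp z - ?supp v) \<union> (?supp v - ?supp z)"
    if z: "z \<in> T" and v: "v \<in> U" for z v
  proof -
    obtain u where u: "u \<in> U" "z = u0 + u" using z TI by auto
    have carr: "u \<in> carrier_vec n" "v \<in> carrier_vec n" using u v U(1) by auto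
    have "z + v = u0 + (u + v)" unfolding u(2) using u0 carr by (rule assoc_add_vec)
    then show "z + v \<in> T" using TI U(3)[OF u(1) v] by auto
    show "?supp (z + v) = (?supp z - ?supp v) \<union> (?supp v - ?supp z)"
      using u(2) u0 carr by (intro vec_support_add) auto
  qed
  have injT: "inj_on (\<lambda>z. ?supp z \<inter> I) T"
  proof (rule inj_onI)
    fix y z assume "y \<in> T" "z \<in> T" and eq: "?supp y \<inter> I = ?supp z \<inter> I"
    then obtain u v where uv: "u \<in> U" "v \<in> U" "y = u0 + u" "z = u0 + v" using TI by auto
    then have "?supp u \<inter> I = ?supp v \<inter> I" using eq supp_T by blast
    then show "y = z" using I(2) uv unfolding inj_on_def by blast
  qed
  \<comment> \<open>Shifting the base point by \<open>v0\<close> clears its coordinates in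
    \<open>I\<close>, so that the section over \<open>x\<close> has trace exactly
    \<open>x\<close>.\<close>
  obtain v0 where v0: "v0 \<in> U" "?supp v0 \<inter> I = ?supp u0 \<inter> I"
    using surj[of "?supp u0 \<inter> I"] by auto
  define u where "u = ?supp (u0 + v0)"
  define W where "W = (SIGMA i:I. ?supp (w i))"
  have uI: "u \<inter> I = {}" using supp_T[OF v0(1)] v0(2) unfolding u_def by blast
  have ex: "(\<exists>z\<in>T. ?supp z = xor_section n u W x) \<and> xor_section n u W x \<inter> I = x" if "x \<subseteq> I" for x
  proof -
    have "finite x" using that finI finite_subset by blast
    then show ?thesis using that
    proof (induction x rule: finite_induct)
      case empty
      have e: "xor_section n u W {} = u" unfolding xor_section_def u_def vec_support_def by auto
      have "u0 + v0 \<in> T" using TI v0(1) by auto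
      then have "\<exists>z\<in>T. ?supp z = u" unfolding u_def by (intro bexI) simp_all
      then show ?case unfolding e using uI by simp
    next
      case (insert i x)
      then obtain z where z: "z \<in> T" "?supp z = xor_section n u W x" and xI: "xor_section n u W x \<inter> I = x" by auto
      have i: "i \<in> I" using insert by auto
      have "xor_section n u W (insert i x)
          = (xor_section n u W x - ?supp (w i)) \<union> (?supp (w i) - xor_section n u W x)"
        using insert.hyps i sub by (intro xor_section_insert) (simp_all add: W_def)
      moreover from this have "xor_section n u W (insert i x) \<inter> I = insert i x"
        using xI w(2)[OF i] insert.hyps by auto
      ultimately show ?case using T_add[OF z(1) w(1)[OF i]] z(2) by metis
    qed
  qed
  have bij: "bij_betw (\<lambda>z. ?supp z \<inter> I) T (Pow I)"
    unfolding bij_betw_def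
  proof (intro conjI injT equalityI subsetI)
    fix x assume "x \<in> Pow I"
    then obtain z where "z \<in> T" "?supp z \<inter> I = x" using ex[of x] by auto
    then show "x \<in> (\<lambda>z. ?supp z \<inter> I) ` T" by blast
  qed auto
  have supp_eq: "?supp z = xor_section n u W (?supp z \<inter> I)" if "z \<in> T" for z
  proof -
    \<comment> \<open>The value of the section is the support of some point of \<open>T\<close> with
      the same trace on \<open>I\<close> as \<open>z\<close>; injectivity on \<open>T\<close> makes
      the two points equal.\<close>
    obtain y where y: "y \<in> T" "?supp y = xor_section n u W (?supp z \<inter> I)" "?supp y \<inter> I = ?supp z \<inter> I"
      using ex[of "?supp z \<inter> I"] by auto
    then have "y = z" using injT that unfolding inj_on_def by blast
    then show ?thesis using y by simp
  qed
  show thesis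
  proof (rule that)
    show "I \<subseteq> {..<n}" "card I = F2_dim n U" by fact+
    show "u \<subseteq> {..<n}" unfolding u_def by (rule sub)
    show "W \<subseteq> I \<times> {..<n}" unfolding W_def using sub by auto
    show "section_over I (xor_section n u W)" unfolding section_over_def using ex by blast
    show "card (affine_translate u0 U) = 2 ^ F2_dim n U"
      using bij_betw_same_card[OF bij] card_Pow[OF finI] cardI unfolding T_def by simp
    fix h :: "nat set \<Rightarrow> real"
    have "(\<Sum>z\<in>T. h (?supp z)) = (\<Sum>z\<in>T. h (xor_section n u W (?supp z \<inter> I)))"
      using supp_eq by (intro sum.cong) auto
    also have "\<dots> = (\<Sum>x\<in>Pow I. h (xor_section n u W x))"
      using bij by (rule sum.reindex_bij_betw)
    finally show "(\<Sum>z\<in>affine_translate u0 U. h (?supp z)) = (\<Sum>x\<in>Pow I. h (xor_section n u W x))"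
      unfolding T_def .
  qed
qed

theorem theorem3p3:
  shows "\<exists>c c' :: real. c > 0 \<and> c' > 0 \<and>
    (\<forall>n d :: nat. 2 \<le> d \<and> real d < real n / 2 \<longrightarrow>
      (\<exists>a :: nat set \<Rightarrow> bit. F2_poly_degree n a = d \<and>
        (\<forall>u\<^sub>0 \<in> carrier_vec n. \<forall>U k. F2_subspace n U \<and> F2_dim n U = k \<and>
            real k \<ge> c * real d * real n powr (1 / (real d - 1)) \<longrightarrow>
          bias (affine_translate u\<^sub>0 U) (F2_poly_eval n a) \<le> 2 powr (- (c' * real k / real d)))))"
\<comment> \<open>160 is the dimension threshold and 1/16 the exponent of the sum bound in
  \<open>card_large_sum_le\<close>.\<close>
proof (rule exI[of _ 160], rule exI[of _ "1/16"], intro conjI allI impI)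
  show "(160::real) > 0" "(1/16::real) > 0" by simp_all
  fix n d :: nat
  assume "2 \<le> d \<and> real d < real n / 2"
  then have d: "2 \<le> d" "2 * d < n" by linarith+
  obtain A where A: "A \<subseteq> monomials {..<n} (Suc d)" "{..<d} \<in> A"
    and small: "\<forall>I u W. I \<subseteq> {..<n} \<and> 160 * real d * real n powr (1 / (real d - 1)) \<le> real (card I) \<and>
      u \<subseteq> {..<n} \<and> W \<subseteq> I \<times> {..<n} \<and> section_over I (xor_section n u W) \<longrightarrow>
      \<bar>\<Sum>x\<in>Pow I. chi A (xor_section n u W x)\<bar> \<le> 2 ^ card I * 2 powr (- (real (card I) / 16))"
    using exists_small_section_sums[OF d] by (elim exE conjE) (rule that)
  have AP: "A \<subseteq> Pow {..<n}" using A(1) unfolding monomials_def by auto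
  let ?a = "\<lambda>S. of_bool (S \<in> A) :: bit"
  show "\<exists>a. F2_poly_degree n a = d \<and>
        (\<forall>u\<^sub>0 \<in> carrier_vec n. \<forall>U k. F2_subspace n U \<and> F2_dim n U = k \<and>
            real k \<ge> 160 * real d * real n powr (1 / (real d - 1)) \<longrightarrow>
          bias (affine_translate u\<^sub>0 U) (F2_poly_eval n a) \<le> 2 powr (- (1/16 * real k / real d)))"
  proof (intro exI[of _ ?a] conjI ballI allI impI)
    show "F2_poly_degree n ?a = d"
      using A by (rule F2_poly_degree_indicator) simp
    fix u0 :: "bit vec" and U k
    assume u0: "u0 \<in> carrier_vec n"
      and "F2_subspace n U \<and> F2_dim n U = k \<and> real k \<ge> 160 * real d * real n powr (1 / (real d - 1))"
    then have U: "F2_subspace n U" and k: "F2_dim n U = k" "160 * real d * real n powr (1 / (real d - 1)) \<le> real k"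
      by auto
    obtain I u W where IuW: "I \<subseteq> {..<n}" "card I = k" "u \<subseteq> {..<n}" "W \<subseteq> I \<times> {..<n}"
        "section_over I (xor_section n u W)"
      and sum: "\<And>h :: nat set \<Rightarrow> real. (\<Sum>z\<in>affine_translate u0 U. h (vec_support n z)) = (\<Sum>x\<in>Pow I. h (xor_section n u W x))"
      and card: "card (affine_translate u0 U) = 2 ^ k"
      using affine_subspace_as_xor_section[OF u0 U] k(1) by metis
    have "\<bar>\<Sum>x\<in>Pow I. chi A (xor_section n u W x)\<bar> \<le> 2 ^ k * 2 powr (- (real k / 16))"
      using small[rule_format, of I u W] IuW k(2) by simp
    then have "bias (affine_translate u0 U) (F2_poly_eval n ?a) \<le> 2 powr (- (real k / 16))"
      unfolding bias_def bit_sign_F2_poly_eval[OF AP] sum card by (simp add: field_simps abs_divide)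
    also have "\<dots> \<le> 2 powr (- (1/16 * real k / real d))"
    proof (intro powr_mono)
      have "real k / 16 / real d \<le> real k / 16 / 1" using d by (intro divide_left_mono) auto
      then show "- (real k / 16) \<le> - (1/16 * real k / real d)" by simp
    qed simp
    finally show "bias (affine_translate u0 U) (F2_poly_eval n ?a) \<le> 2 powr (- (1/16 * real k / real d))" .
  qed
qed

end
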